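(* Suppose that $J(x,y)$ is nonconvex in $x$ and $-J(x,y)$ is $\nu$-PL in $y$ for some $\nu>0$, i.e. $\|\nabla_yJ(x,y)\|^2\ge2\nu\big(\max_{y'}J(x,y')-J(x,y)\big)$ for all $x\in\mathbb{R}^{M_1},y\in\mathbb{R}^{M_2}$; that the stochastic gradients and Hessians satisfy the unbiasedness, bounded-variance and independence conditions stated in the context; that $P(x)=\max_yJ(x,y)$ satisfies $P^\star=\inf_xP(x)>-\infty$; and that $\nabla_zJ$ is $L_f$-Lipschitz and $\nabla^2_{zz}J$ is $L_h$-Lipschitz. The stability condition for the hyperparameters in HCMM-2 is given by $$\beta_x=\beta_y\le1,\qquad\mu_x\le\min\Big\{\mu_y,\frac{\mu_y}{6\kappa}\Big\},$$ where $\kappa=L_f/\nu$ is the condition number. Choose the smoothing factors as $\beta_x=\beta_y=\mathcal{O}\big(\frac{1}{T^{2/3}}\big)$ and $\mu_y=\mathcal{O}\big(\frac{1}{T^{2/3}}\big)$, $\mu_x=c_3\mu_y$ for a small constant $c_3<1$. Then the convergence rate of HCMM-2 is given by $$\frac1T\sum_{i=0}^{T-1}\mathbb{E}\|\nabla P(\boldsymbol{x}_i)\|\le\mathcal{O}\Big(\frac1{T^{1/3}}\Big)+\mathcal{O}\Big(\frac1T\Big)+\mathcal{O}\Big(\frac1{T^{2/3}}\Big).$$ That is, HCMM-2 outputs an $\varepsilon$-stationary point $\boldsymbol{x}^\star$ (meaning $\mathbb{E}\|\nabla P(\boldsymbol{x}^\star)\|\le\varepsilon$) after $T=\mathcal{O}(\varepsilon^{-3})$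 iterations and oracle complexity.
   Context: Problem: $\min_{x\in\mathbb{R}^{M_1}}\max_{y\in\mathbb{R}^{M_2}}J(x,y)$ with $J(x,y)=\mathbb{E}_{\boldsymbol{\xi}}Q(x,y;\boldsymbol{\xi})$. Write $z=(x,y)$ for the concatenated variable, $\nabla_zJ=[\nabla_xJ;\nabla_yJ]$, and $\nabla^2_{zz}J$ for the full Hessian with blocks $\nabla^2_{xx}J,\nabla^2_{xy}J,\nabla^2_{yx}J,\nabla^2_{yy}J$; similarly for $Q$. $\|\cdot\|$ is the Euclidean norm for vectors and the spectral norm for matrices. Lipschitz conditions: $\|\nabla_zJ(z_1)-\nabla_zJ(z_2)\|\le L_f\|z_1-z_2\|$ and $\|\nabla^2_{zz}J(z_1)-\nabla^2_{zz}J(z_2)\|\le L_h\|z_1-z_2\|$ for all $z_1,z_2$. Noise conditions: the samples $\boldsymbol{\xi}_i$ are independent of each other for all $i$; with $\boldsymbol{z}_i=(\boldsymbol{x}_i,\boldsymbol{y}_i)$ the iterates and $\boldsymbol{\mathcal{F}}_i$ the $\sigma$-algebra generated by $\boldsymbol{z}_0,\dots,\boldsymbol{z}_i$: $\mathbb{E}\{\nabla_zQ(\boldsymbol{z}_i;\boldsymbol{\xi}_i)\mid\boldsymbol{\mathcal{F}}_i\}=\nabla_zJ(\boldsymbol{z}_i)$, $\mathbb{E}\{\|\nabla_zQ(\boldsymbol{z}_i;\boldsymbol{\xi}_i)-\nabla_zJ(\boldsymbol{z}_i)\|^2\mid\boldsymbol{\mathcal{F}}_i\}\le\sigma^2$,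 $\mathbb{E}\{\nabla^2_{zz}Q(\boldsymbol{z}_i;\boldsymbol{\xi}_i)\mid\boldsymbol{\mathcal{F}}_i\}=\nabla^2_{zz}J(\boldsymbol{z}_i)$, $\mathbb{E}\{\|\nabla^2_{zz}Q(\boldsymbol{z}_i;\boldsymbol{\xi}_i)-\nabla^2_{zz}J(\boldsymbol{z}_i)\|^2\mid\boldsymbol{\mathcal{F}}_i\}\le\sigma_h^2$, with nonnegative constants $\sigma^2,\sigma_h^2$. Algorithm HCMM-2 (parameters: step sizes $\mu_x,\mu_y$, smoothing factors $\beta_x,\beta_y$). Given $\boldsymbol{x}_0,\boldsymbol{m}_{x,0}\in\mathbb{R}^{M_1}$ and $\boldsymbol{y}_0,\boldsymbol{m}_{y,0}\in\mathbb{R}^{M_2}$, set $\boldsymbol{x}_1=\boldsymbol{x}_0-\mu_x\boldsymbol{m}_{x,0}/\|\boldsymbol{m}_{x,0}\|$, $\boldsymbol{y}_1=\boldsymbol{y}_0+\mu_y\boldsymbol{m}_{y,0}/\|\boldsymbol{m}_{y,0}\|$. For $i=1,2,\dots$: $$\boldsymbol{m}_{x,i}=(1-\beta_x)\big[\boldsymbol{m}_{x,i-1}+\nabla^2_{xx}Q(\boldsymbol{z}_i;\boldsymbol{\xi}_i)(\boldsymbol{x}_i-\boldsymbol{x}_{i-1})+\nabla^2_{xy}Q(\boldsymbol{z}_i;\boldsymbol{\xi}_i)(\boldsymbol{y}_i-\boldsymbol{y}_{i-1})\big]+\beta_x\nabla_xQ(\boldsymbol{z}_i;\boldsymbol{\xi}_i),$$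 $$\boldsymbol{m}_{y,i}=(1-\beta_y)\big[\boldsymbol{m}_{y,i-1}+\nabla^2_{yy}Q(\boldsymbol{z}_i;\boldsymbol{\xi}_i)(\boldsymbol{y}_i-\boldsymbol{y}_{i-1})+\nabla^2_{yx}Q(\boldsymbol{z}_i;\boldsymbol{\xi}_i)(\boldsymbol{x}_i-\boldsymbol{x}_{i-1})\big]+\beta_y\nabla_yQ(\boldsymbol{z}_i;\boldsymbol{\xi}_i),$$ $\boldsymbol{x}_{i+1}=\boldsymbol{x}_i-\mu_x\boldsymbol{m}_{x,i}/\|\boldsymbol{m}_{x,i}\|$, $\boldsymbol{y}_{i+1}=\boldsymbol{y}_i+\mu_y\boldsymbol{m}_{y,i}/\|\boldsymbol{m}_{y,i}\|$. $T$ is the number of iterations. *)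

theory Defs
  imports "HOL-Probability.Probability" "HOL-Library.Landau_Symbols"
begin

definition grad :: "('a::real_inner \<Rightarrow> real) \<Rightarrow> 'a \<Rightarrow> 'a" where
  "grad f z = (THE D. GDERIV f z :> D)"

text \<open>
  The Hessian is a bounded linear map on the product space. The norm of the type is the
  operator norm with respect to the Euclidean norm, i.e. the spectral norm; likewise, the norm
  on a product is the Euclidean norm of the concatenated vector.
\<close>

definition hess :: "('a::euclidean_space \<Rightarrow> real) \<Rightarrow> 'a \<Rightarrow> ('a \<Rightarrow>\<^sub>L 'a)" where
  "hess f z = Blinfun (frechet_derivative (grad f) (at z))"

definition twice_differentiable :: "('a::euclidean_space \<Rightarrow> real) \<Rightarrow> bool" where
  "twice_differentiable f \<longleftrightarrow>
     (\<forall>z. \<exists>D. GDERIV f z :> D) \<and> (\<forall>z. grad f differentiable (at z))"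

definition grad_x :: "('a::euclidean_space \<times> 'b::euclidean_space \<Rightarrow> real) \<Rightarrow> 'a \<times> 'b \<Rightarrow> 'a" where
  "grad_x f z = fst (grad f z)"

definition grad_y :: "('a::euclidean_space \<times> 'b::euclidean_space \<Rightarrow> real) \<Rightarrow> 'a \<times> 'b \<Rightarrow> 'b" where
  "grad_y f z = snd (grad f z)"

definition hess_xx :: "('a::euclidean_space \<times> 'b::euclidean_space \<Rightarrow> real) \<Rightarrow> 'a \<times> 'b \<Rightarrow> 'a \<Rightarrow> 'a" where
  "hess_xx f z u = fst (blinfun_apply (hess f z) (u, 0))"

definition hess_xy :: "('a::euclidean_space \<times> 'b::euclidean_space \<Rightarrow> real) \<Rightarrow> 'a \<times> 'b \<Rightarrow> 'b \<Rightarrow> 'a" where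
  "hess_xy f z v = fst (blinfun_apply (hess f z) (0, v))"

definition hess_yx :: "('a::euclidean_space \<times> 'b::euclidean_space \<Rightarrow> real) \<Rightarrow> 'a \<times> 'b \<Rightarrow> 'a \<Rightarrow> 'b" where
  "hess_yx f z u = snd (blinfun_apply (hess f z) (u, 0))"

definition hess_yy :: "('a::euclidean_space \<times> 'b::euclidean_space \<Rightarrow> real) \<Rightarrow> 'a \<times> 'b \<Rightarrow> 'b \<Rightarrow> 'b" where
  "hess_yy f z v = snd (blinfun_apply (hess f z) (0, v))"

text \<open>The supremum is a maximum only where it is attained; attainment is stated separately.\<close>

definition primal :: "('a \<times> 'b \<Rightarrow> real) \<Rightarrow> 'a \<Rightarrow> real" where
  "primal J x = (SUP y. J (x, y))"

definition max_attained :: "('a \<times> 'b \<Rightarrow> real) \<Rightarrow> bool" where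
  "max_attained J \<longleftrightarrow> (\<forall>x. \<exists>y. \<forall>y'. J (x, y') \<le> J (x, y))"

text \<open>
  State \<open>i\<close> of a run consists of the iterate with index \<open>i\<close>, the momentum with the same index,
  and the number of evaluations made so far of stochastic gradient blocks and of products of
  stochastic Hessian blocks with vectors. The sample \<open>\<xi> 0\<close> is never used. The normalised
  direction is \<open>0\<close> when the momentum vanishes.
\<close>

record ('m, 'n) hcmm_state =
  xvar :: "real ^ 'm"
  yvar :: "real ^ 'n"
  xmom :: "real ^ 'm"
  ymom :: "real ^ 'n"
  calls :: nat

definition hcmm2_step ::
  "real \<Rightarrow> real \<Rightarrow> real \<Rightarrow> real
   \<Rightarrow> ((real ^ 'm::finite) \<times> (real ^ 'n::finite) \<Rightarrow> 's \<Rightarrow> real) \<Rightarrow> 's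
   \<Rightarrow> ('m, 'n) hcmm_state \<Rightarrow> ('m, 'n) hcmm_state" where
  "hcmm2_step \<mu>x \<mu>y \<beta>x \<beta>y Q s st =
    (let x = xvar st - \<mu>x *\<^sub>R (xmom st /\<^sub>R norm (xmom st));
         y = yvar st + \<mu>y *\<^sub>R (ymom st /\<^sub>R norm (ymom st));
         q = (\<lambda>z. Q z s)
     in \<lparr>xvar = x,
         yvar = y,
         xmom = (1 - \<beta>x) *\<^sub>R (xmom st + hess_xx q (x, y) (x - xvar st)
                                   + hess_xy q (x, y) (y - yvar st))
                + \<beta>x *\<^sub>R grad_x q (x, y),
         ymom = (1 - \<beta>y) *\<^sub>R (ymom st + hess_yy q (x, y) (y - yvar st)
                                   + hess_yx q (x, y) (x - xvar st))
                + \<beta>y *\<^sub>R grad_y q (x, y),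
         calls = calls st + 6\<rparr>)"

primrec hcmm2 ::
  "real \<Rightarrow> real \<Rightarrow> real \<Rightarrow> real
   \<Rightarrow> ((real ^ 'm::finite) \<times> (real ^ 'n::finite) \<Rightarrow> 's \<Rightarrow> real)
   \<Rightarrow> ('m, 'n) hcmm_state \<Rightarrow> (nat \<Rightarrow> 's) \<Rightarrow> nat \<Rightarrow> ('m, 'n) hcmm_state" where
  "hcmm2 \<mu>x \<mu>y \<beta>x \<beta>y Q init \<xi> 0 = init"
| "hcmm2 \<mu>x \<mu>y \<beta>x \<beta>y Q init \<xi> (Suc i) =
     hcmm2_step \<mu>x \<mu>y \<beta>x \<beta>y Q (\<xi> (Suc i)) (hcmm2 \<mu>x \<mu>y \<beta>x \<beta>y Q init \<xi> i)"

definition history ::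
  "'w measure \<Rightarrow> (nat \<Rightarrow> 'w \<Rightarrow> 'z::topological_space) \<Rightarrow> nat \<Rightarrow> 'w measure" where
  "history M z i = sigma (space M) {z j -` A \<inter> space M | j A. j \<le> i \<and> A \<in> sets borel}"

text \<open>Conditional expectation of a vector, taken coordinate by coordinate.\<close>

definition has_cond_exp ::
  "'w measure \<Rightarrow> 'w measure \<Rightarrow> ('w \<Rightarrow> 'b::euclidean_space) \<Rightarrow> ('w \<Rightarrow> 'b) \<Rightarrow> bool" where
  "has_cond_exp M F f g \<longleftrightarrow> integrable M f \<and>
     (\<forall>b\<in>Basis. AE \<omega> in M. real_cond_exp M F (\<lambda>\<omega>. f \<omega> \<bullet> b) \<omega> = g \<omega> \<bullet> b)"

definition unbiased_bounded_noise ::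
  "'w measure \<Rightarrow> ('z::euclidean_space \<Rightarrow> 's \<Rightarrow> real) \<Rightarrow> ('z \<Rightarrow> real) \<Rightarrow> real \<Rightarrow> real
   \<Rightarrow> (nat \<Rightarrow> 'w \<Rightarrow> 'z) \<Rightarrow> (nat \<Rightarrow> 'w \<Rightarrow> 's) \<Rightarrow> nat \<Rightarrow> bool" where
  "unbiased_bounded_noise M Q J \<sigma> \<sigma>h z \<xi> i \<longleftrightarrow>
     (let F = history M z i;
          G = (\<lambda>\<omega>. grad (\<lambda>z. Q z (\<xi> i \<omega>)) (z i \<omega>));
          H = (\<lambda>\<omega>. hess (\<lambda>z. Q z (\<xi> i \<omega>)) (z i \<omega>))
      in has_cond_exp M F G (\<lambda>\<omega>. grad J (z i \<omega>)) \<and>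
         (AE \<omega> in M. nn_cond_exp M F
            (\<lambda>\<omega>. ennreal ((norm (G \<omega> - grad J (z i \<omega>)))\<^sup>2)) \<omega> \<le> ennreal (\<sigma>\<^sup>2)) \<and>
         (\<forall>u. has_cond_exp M F (\<lambda>\<omega>. blinfun_apply (H \<omega>) u)
                 (\<lambda>\<omega>. blinfun_apply (hess J (z i \<omega>)) u)) \<and>
         (AE \<omega> in M. nn_cond_exp M F
            (\<lambda>\<omega>. ennreal ((norm (H \<omega> - hess J (z i \<omega>)))\<^sup>2)) \<omega> \<le> ennreal (\<sigma>h\<^sup>2)))"

definition stationary_point ::
  "'w measure \<Rightarrow> ('a::euclidean_space \<Rightarrow> real) \<Rightarrow> real \<Rightarrow> ('w \<Rightarrow> 'a) \<Rightarrow> bool" where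
  "stationary_point M P \<epsilon> X \<longleftrightarrow>
     integrable M (\<lambda>\<omega>. norm (grad P (X \<omega>))) \<and> (\<integral>\<omega>. norm (grad P (X \<omega>)) \<partial>M) \<le> \<epsilon>"

end

theory Submission
  imports Defs
begin

text \<open>
  The Polyak-Lojasiewicz condition gives an error bound: every \<open>y\<close> is within
  \<open>2 / \<nu> * norm (grad_y J (u, y))\<close> of a maximiser of \<open>J (u, _)\<close>. Hence \<open>primal J\<close> has the
  Lipschitz gradient \<open>grad_x J\<close> at any maximiser, and \<open>grad_x J\<close> differs from it by at most
  \<open>2 * \<kappa> * norm (grad_y J)\<close>. With \<open>6 * \<kappa> * \<mu>x \<le> \<mu>y\<close>, the function
  \<open>2 * primal J u - J (u, y)\<close> therefore decreases along the normalised steps by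
  \<open>\<mu>x * norm (grad (primal J) u)\<close>, up to second order terms and the momentum error.

  The momentum error is the sum of a bias, which contracts by \<open>1 - \<beta>\<close> in each iteration and
  receives a Taylor remainder of order \<open>\<mu>\<^sup>2\<close> thanks to the Hessian correction, and of a geometrically
  weighted sum of uncorrelated noise terms of variance of order \<open>\<mu>\<^sup>2 + \<beta>\<^sup>2\<close>. Its expected norm is of
  order \<open>(1 - \<beta>)\<^sup>i + \<mu>\<^sup>2 / \<beta> + sqrt ((\<mu>\<^sup>2 + \<beta>\<^sup>2) / \<beta>)\<close>, which averages to \<open>T powr (- 1 / 3)\<close>.
\<close>

section \<open>Error bound and Taylor estimates\<close>

text \<open>The scale T^(-2/3) comes from balancing two costs. Dividing the telescoped descent by
  \<open>T * \<mu>x\<close> leaves the initial gap at order 1 / (T * \<mu>), while for \<beta>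
  proportional to \<mu> the noise floor is of order sqrt \<mu>. Without the Hessian correction the
  drift of the gradient along a step would enter at order \<mu> and be amplified by 1 / \<beta> to a
  constant.

  A triangle inequality in each step would likewise add noise of order \<mu> + \<beta> and, after
  summation with ratio 1 - \<beta>, leave a floor that does not decay. Hence the noise is treated in
  mean square, where orthogonality gains a square root, and the bias pathwise, where a first moment
  of the initial error suffices.

  Orthogonality is the delicate point. Unbiasedness is conditional on the iterates, but
  normalisation hides the length of the momentum, so the momentum need not be measurable with
  respect to them. Independence of the new sample from everything earlier closes this gap.\<close>

lemma grad_eqI:
  assumes "GDERIV f z :> D"
  shows "grad f z = D"
  unfolding grad_def
proof (rule the_equality)
  show "GDERIV f z :> D" by (rule assms)
next
  fix E assume "GDERIV f z :> E"
  with assms have eq: "(\<lambda>h. h \<bullet> E) = (\<lambda>h. h \<bullet> D)"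
    unfolding gderiv_def by (rule has_derivative_unique[rotated])
  show "E = D"
    using fun_cong[OF eq, of "E - D"] by (metis inner_diff_right inner_eq_zero_iff right_minus_eq)
qed

lemma twice_differentiable_GDERIV:
  assumes "twice_differentiable f"
  shows "GDERIV f z :> grad f z"
  using assms grad_eqI unfolding twice_differentiable_def by metis

lemma twice_differentiable_hess:
  assumes "twice_differentiable f"
  shows "(grad f has_derivative blinfun_apply (hess f z)) (at z)"
proof -
  have "(grad f has_derivative frechet_derivative (grad f) (at z)) (at z)"
    using assms frechet_derivative_works unfolding twice_differentiable_def by blast
  moreover from this have "bounded_linear (frechet_derivative (grad f) (at z))"
    by (rule has_derivative_bounded_linear)
  ultimately show ?thesis
    by (simp add: hess_def bounded_linear_Blinfun_apply)
qed

text \<open>On the ball around \<open>z\<close> of radius \<open>norm (w - z)\<close> the derivative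
  stays within \<open>L * norm (w - z)\<close> of \<open>f' z\<close>; the mean value inequality
  uses this uniformly, hence \<open>L\<close> instead of \<open>L / 2\<close>. The hypothesis is
  stated on vectors so that it covers gradients, where \<open>f'\<close> is an inner product, as
  well as Hessians.\<close>

lemma taylor_lipschitz_derivative:
  fixes f :: "'a::real_normed_vector \<Rightarrow> 'b::real_normed_vector"
  assumes der: "\<And>x. (f has_derivative f' x) (at x)"
    and lip: "\<And>x h. norm (f' x h - f' z h) \<le> L * norm (x - z) * norm h"
    and "L \<ge> 0"
  shows "norm (f w - f z - f' z (w - z)) \<le> L * (norm (w - z))\<^sup>2"
proof -
  have "norm (f w - f z - f' z (w - z)) \<le> norm (w - z) * (L * norm (w - z))"
  proof (rule differentiable_bound_linearization[where S = "cball z (norm (w - z))" and f' = f'])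
    fix t :: real assume "t \<in> {0..1}"
    then show "z + t *\<^sub>R (w - z) \<in> cball z (norm (w - z))"
      by (auto simp: dist_norm intro: mult_left_le_one_le)
  next
    fix x show "(f has_derivative f' x) (at x within cball z (norm (w - z)))"
      using der by (rule has_derivative_at_withinI)
  next
    fix x assume "x \<in> cball z (norm (w - z))"
    then have "norm (x - z) \<le> norm (w - z)"
      by (simp add: dist_norm norm_minus_commute)
    then have "L * norm (x - z) \<le> L * norm (w - z)"
      using \<open>L \<ge> 0\<close> by (rule mult_left_mono)
    moreover have "onorm (f' x - f' z) \<le> L * norm (x - z)"
      using lip \<open>L \<ge> 0\<close> by (intro onorm_bound) auto
    ultimately show "onorm (f' x - f' z) \<le> L * norm (w - z)" by simp
  qed simp
  then show ?thesis by (simp add: power2_eq_square mult_ac)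
qed

lemma taylor_lipschitz_gradient:
  assumes "\<And>x. GDERIV f x :> g x" and "L-lipschitz_on UNIV g"
  shows "\<bar>f w - f z - g z \<bullet> (w - z)\<bar> \<le> L * (norm (w - z))\<^sup>2"
proof -
  have "norm (f w - f z - (w - z) \<bullet> g z) \<le> L * (norm (w - z))\<^sup>2"
  proof (rule taylor_lipschitz_derivative[where f' = "\<lambda>x h. h \<bullet> g x"])
    show "(f has_derivative (\<lambda>h. h \<bullet> g x)) (at x)" for x
      using assms(1) by (simp add: gderiv_def)
    fix x h
    have "norm (h \<bullet> g x - h \<bullet> g z) \<le> norm h * norm (g x - g z)"
      by (metis inner_diff_right Cauchy_Schwarz_ineq2 real_norm_def)
    also have "\<dots> \<le> norm h * (L * norm (x - z))"
      using lipschitz_onD[OF assms(2), of x z] by (intro mult_left_mono) (auto simp: dist_norm)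
    finally show "norm (h \<bullet> g x - h \<bullet> g z) \<le> L * norm (x - z) * norm h"
      by (simp add: mult_ac)
  qed (rule lipschitz_on_nonneg[OF assms(2)])
  then show ?thesis by (simp add: inner_commute)
qed

text \<open>The vector \<open>m\<close> has inner product \<open>norm m\<close> with its own
  direction; replacing \<open>m\<close> by \<open>g\<close> costs \<open>norm (m - g)\<close> once
  in the product and once in the length. For \<open>m = 0\<close> the direction is 0 and the
  right-hand side is \<open>- norm g\<close>.\<close>

lemma inner_normalized_ge:
  fixes g m :: "'a::real_inner"
  shows "g \<bullet> (m /\<^sub>R norm m) \<ge> norm g - 2 * norm (m - g)"
proof (cases "m = 0")
  case False
  have "m \<bullet> (m /\<^sub>R norm m) = norm m"
    using False by (simp add: dot_square_norm power2_eq_square)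
  then have "g \<bullet> (m /\<^sub>R norm m) = norm m - (m - g) \<bullet> (m /\<^sub>R norm m)"
    unfolding inner_diff_left by linarith
  moreover have "(m - g) \<bullet> (m /\<^sub>R norm m) \<le> norm (m - g)"
    using norm_cauchy_schwarz[of "m - g" "m /\<^sub>R norm m"] False by simp
  moreover have "norm g - norm (m - g) \<le> norm m"
    using norm_triangle_ineq2[of g m] by (simp add: norm_minus_commute)
  ultimately show ?thesis by linarith
qed simp

lemma norm_normalized_le: "norm (m /\<^sub>R norm m) \<le> 1"
  by (cases "m = 0") auto

text \<open>
  Ekeland-type argument: \<open>sqrt f\<close> has slope at least \<open>sqrt (\<nu> / 2)\<close> wherever \<open>f\<close> is positive, so
  a minimiser of \<open>sqrt f + c * norm (_ - y)\<close> for a smaller \<open>c\<close> can only be a zero of \<open>f\<close>.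
\<close>

lemma pl_error_bound:
  fixes f :: "'a::euclidean_space \<Rightarrow> real"
  assumes nonneg: "\<And>w. f w \<ge> 0"
    and descent: "\<And>y w. f w \<le> f y + g y \<bullet> (w - y) + L * (norm (w - y))\<^sup>2"
    and cont: "continuous_on UNIV f"
    and pl: "\<And>y. (norm (g y))\<^sup>2 \<ge> 2 * \<nu> * f y"
    and "\<nu> > 0" "L > 0"
  shows "\<exists>w. f w = 0 \<and> norm (w - y) \<le> 2 / \<nu> * norm (g y)"
proof -
  \<comment> \<open>Half the slope \<open>sqrt (\<nu> / 2)\<close>. Since
    \<open>sqrt (2 * \<nu>) * c = \<nu> / 2\<close>, it produces the constant
    \<open>2 / \<nu>\<close> of the bound.\<close>
  define c where "c = sqrt (2 * \<nu>) / 4"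
  have c: "c > 0" using \<open>\<nu> > 0\<close> by (simp add: c_def)
  define \<phi> where "\<phi> w = sqrt (f w) + c * norm (w - y)" for w
  have "continuous_on (cball y (sqrt (f y) / c)) \<phi>"
    unfolding \<phi>_def by (intro continuous_intros continuous_on_subset[OF cont]) auto
  moreover have "cball y (sqrt (f y) / c) \<noteq> {}"
    using nonneg[of y] c by (simp add: not_less)
  ultimately obtain w where w: "w \<in> cball y (sqrt (f y) / c)"
    and min_ball: "\<And>v. v \<in> cball y (sqrt (f y) / c) \<Longrightarrow> \<phi> w \<le> \<phi> v"
    using continuous_attains_inf[of "cball y (sqrt (f y) / c)" \<phi>] by (metis compact_cball)
  have wy: "\<phi> w \<le> sqrt (f y)"
    using min_ball[of y] nonneg c by (simp add: \<phi>_def)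
  \<comment> \<open>Outside the ball the penalty alone exceeds \<open>\<phi> y = sqrt (f y)\<close>,
    so the minimiser on the compact ball is global.\<close>
  have min: "\<phi> w \<le> \<phi> v" for v
  proof (cases "v \<in> cball y (sqrt (f y) / c)")
    case False
    then have "sqrt (f y) \<le> c * norm (v - y)"
      using c by (simp add: dist_norm norm_minus_commute field_simps)
    then have "sqrt (f y) \<le> \<phi> v"
      using nonneg[of v] by (simp add: \<phi>_def add_increasing)
    with wy show ?thesis by simp
  qed (rule min_ball)
  have slope: "sqrt (f w) - sqrt (f v) \<le> c * norm (v - w)" for v
  proof -
    have "c * norm (v - y) \<le> c * (norm (v - w) + norm (w - y))"
      using c norm_triangle_ineq[of "v - w" "w - y"] by (intro mult_left_mono) auto
    then show ?thesis using min[of v] by (simp add: \<phi>_def algebra_simps)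
  qed
  have "f w = 0"
  proof (rule ccontr)
    assume "f w \<noteq> 0"
    with nonneg[of w] have pos: "f w > 0" by simp
    \<comment> \<open>A step this short loses only a quarter of the first order gain:
      \<open>f\<close> drops by \<open>3 / 4 * t * (norm (g w))\<^sup>2\<close>. Minimality of
      \<open>w\<close> permits a drop of at most \<open>1 / 2 * t * (norm (g w))\<^sup>2\<close>,
      whence the contradiction.\<close>
    define t where "t = 1 / (4 * L)"
    define v where "v = w - t *\<^sub>R g w"
    have t: "t > 0" "L * t = 1 / 4" using \<open>L > 0\<close> by (auto simp: t_def)
    have g: "norm (g w) \<ge> sqrt (2 * \<nu>) * sqrt (f w)"
      using pl[of w] unfolding real_sqrt_mult[symmetric] by (simp add: real_le_lsqrt)
    then have gpos: "norm (g w) > 0"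
      using pos \<open>\<nu> > 0\<close> by (intro less_le_trans[OF _ g]) simp
    have "f v \<le> f w - t * (norm (g w))\<^sup>2 + L * t * t * (norm (g w))\<^sup>2"
      using descent[of v w] t
      by (simp add: v_def dot_square_norm power_mult_distrib power2_eq_square mult_ac)
    then have dec: "3 / 4 * t * (norm (g w))\<^sup>2 \<le> f w - f v"
      by (simp add: t(2) algebra_simps)
    moreover have "0 \<le> 3 / 4 * t * (norm (g w))\<^sup>2" using t by simp
    ultimately have vw: "sqrt (f v) \<le> sqrt (f w)" by simp
    have nv: "norm (v - w) = t * norm (g w)" using t by (simp add: v_def)
    have "f w - f v = (sqrt (f w) - sqrt (f v)) * (sqrt (f w) + sqrt (f v))"
      using nonneg by (simp add: algebra_simps)
    also have "\<dots> \<le> (c * norm (v - w)) * (2 * sqrt (f w))"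
      using vw slope[of v] nonneg c by (intro mult_mono) auto
    also have "\<dots> = (t * norm (g w)) * ((sqrt (2 * \<nu>) * sqrt (f w)) / 2)"
      unfolding nv c_def by simp
    also have "\<dots> \<le> (t * norm (g w)) * (norm (g w) / 2)"
      using t g by (intro mult_left_mono) auto
    also have "\<dots> = 1 / 2 * t * (norm (g w))\<^sup>2"
      by (simp add: power2_eq_square)
    also have "\<dots> < 3 / 4 * t * (norm (g w))\<^sup>2"
      using t gpos by simp
    finally show False using dec by simp
  qed
  moreover have "norm (w - y) \<le> 2 / \<nu> * norm (g y)"
  proof -
    have "sqrt (2 * \<nu>) * sqrt (f y) \<le> norm (g y)"
      using pl[of y] unfolding real_sqrt_mult[symmetric] by (simp add: real_le_lsqrt)
    moreover have "c * norm (w - y) \<le> sqrt (f y)"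
      using wy \<open>f w = 0\<close> by (simp add: \<phi>_def)
    then have "sqrt (2 * \<nu>) * (c * norm (w - y)) \<le> sqrt (2 * \<nu>) * sqrt (f y)"
      using \<open>\<nu> > 0\<close> by (intro mult_left_mono) auto
    moreover have "sqrt (2 * \<nu>) * (c * norm (w - y)) = \<nu> / 2 * norm (w - y)"
      using \<open>\<nu> > 0\<close> by (simp add: c_def field_simps)
    ultimately have "\<nu> / 2 * norm (w - y) \<le> norm (g y)" by simp
    then show ?thesis using \<open>\<nu> > 0\<close> by (simp add: field_simps)
  qed
  ultimately show ?thesis by blast
qed

section \<open>Primal function and descent\<close>

locale pl_saddle =
  fixes J :: "'a::euclidean_space \<times> 'b::euclidean_space \<Rightarrow> real" and L \<nu> \<kappa> :: real
  assumes J_diff: "\<And>z. GDERIV J z :> grad J z"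
    and J_max: "max_attained J"
    and nu_pos: "\<nu> > 0"
    and PL: "\<And>u v. (norm (grad_y J (u, v)))\<^sup>2 \<ge> 2 * \<nu> * (primal J u - J (u, v))"
    and L_pos: "L > 0"
    and grad_lip: "L-lipschitz_on UNIV (grad J)"
    and kappa: "\<kappa> = L / \<nu>"
begin

lemma kappa_pos: "\<kappa> > 0"
  using L_pos nu_pos kappa by simp

text \<open>\<open>L * (1 + 2 * \<kappa>)\<close> accounts for the change of \<open>grad_x J\<close>
  when base point and maximiser move together; the further \<open>L\<close> is the Taylor remainder
  in the first block.\<close>

definition smoothness :: real where
  "smoothness = L * (2 + 2 * \<kappa>)"

lemma smoothness_pos: "smoothness > 0"
  using L_pos kappa_pos by (simp add: smoothness_def)

lemma primal_attained:
  obtains y where "J (u, y) = primal J u"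
proof -
  obtain y where y: "\<And>y'. J (u, y') \<le> J (u, y)"
    using J_max unfolding max_attained_def by metis
  then have "primal J u = J (u, y)"
    unfolding primal_def by (intro cSup_eq_maximum) auto
  with that show thesis by simp
qed

lemma le_primal: "J (u, y) \<le> primal J u"
proof -
  obtain y where y: "\<And>y'. J (u, y') \<le> J (u, y)"
    using J_max unfolding max_attained_def by metis
  then have "bdd_above (range (\<lambda>y. J (u, y)))" by (intro bdd_aboveI2)
  then show ?thesis unfolding primal_def by (intro cSUP_upper) auto
qed

lemma taylor_J: "\<bar>J w - J z - grad J z \<bullet> (w - z)\<bar> \<le> L * (norm (w - z))\<^sup>2"
  using J_diff grad_lip by (rule taylor_lipschitz_gradient)

lemma taylor_y:
  "\<bar>J (u, w) - J (u, y) - grad_y J (u, y) \<bullet> (w - y)\<bar> \<le> L * (norm (w - y))\<^sup>2"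
  using taylor_J[of "(u, w)" "(u, y)"] by (simp add: grad_y_def inner_prod_def norm_Pair)

lemma taylor_x:
  "\<bar>J (w, y) - J (u, y) - grad_x J (u, y) \<bullet> (w - u)\<bar> \<le> L * (norm (w - u))\<^sup>2"
  using taylor_J[of "(w, y)" "(u, y)"] by (simp add: grad_x_def inner_prod_def norm_Pair)

lemma grad_x_diff_le: "norm (grad_x J z - grad_x J w) \<le> L * norm (z - w)"
proof -
  have "norm (fst (grad J z - grad J w)) \<le> norm (grad J z - grad J w)"
    by (metis norm_fst_le prod.collapse)
  then show ?thesis
    using lipschitz_onD[OF grad_lip, of z w] by (simp add: grad_x_def dist_norm)
qed

lemma grad_y_diff_le: "norm (grad_y J z - grad_y J w) \<le> L * norm (z - w)"
proof -
  have "norm (snd (grad J z - grad J w)) \<le> norm (grad J z - grad J w)"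
    by (metis norm_snd_le prod.collapse)
  then show ?thesis
    using lipschitz_onD[OF grad_lip, of z w] by (simp add: grad_y_def dist_norm)
qed

text \<open>An ascent step of factor \<open>1 / (2 * L)\<close> in the second block gains at least
  \<open>(norm g)\<^sup>2 / (4 * L)\<close> and cannot rise above the maximum. A zero gap thus
  forces a zero partial gradient.\<close>

lemma norm_grad_y_le: "(norm (grad_y J (u, y)))\<^sup>2 \<le> 4 * L * (primal J u - J (u, y))"
proof -
  define g where "g = grad_y J (u, y)"
  define t where "t = 1 / (2 * L)"
  have "J (u, y) + t * (norm g)\<^sup>2 - L * (t\<^sup>2 * (norm g)\<^sup>2) \<le> J (u, y + t *\<^sub>R g)"
    using taylor_y[of u "y + t *\<^sub>R g" y]
    by (simp add: g_def[symmetric] dot_square_norm power_mult_distrib abs_le_iff)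
  also have "\<dots> \<le> primal J u" by (rule le_primal)
  also have "L * (t\<^sup>2 * (norm g)\<^sup>2) = t * (norm g)\<^sup>2 / 2"
    using L_pos by (simp add: t_def power2_eq_square)
  finally have "t * (norm g)\<^sup>2 \<le> 2 * (primal J u - J (u, y))" by simp
  then have "2 * L * (t * (norm g)\<^sup>2) \<le> 2 * L * (2 * (primal J u - J (u, y)))"
    using L_pos by (intro mult_left_mono) auto
  then show ?thesis
    using L_pos by (simp add: g_def[symmetric] t_def algebra_simps)
qed

lemma grad_y_maximizer: "J (u, y) = primal J u \<Longrightarrow> grad_y J (u, y) = 0"
  using norm_grad_y_le[of u y] by simp

lemma near_maximizer:
  obtains w where "J (u, w) = primal J u" "norm (w - y) \<le> 2 / \<nu> * norm (grad_y J (u, y))"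
proof -
  have "continuous_on UNIV J"
    using J_diff unfolding gderiv_def by (rule has_derivative_continuous_on[OF has_derivative_at_withinI])
  then have cont: "continuous_on UNIV (\<lambda>w. primal J u - J (u, w))"
    by (intro continuous_intros continuous_on_compose2[of UNIV J UNIV "Pair u"]) auto
  have "\<exists>w. primal J u - J (u, w) = 0 \<and> norm (w - y) \<le> 2 / \<nu> * norm (- grad_y J (u, y))"
  proof (rule pl_error_bound[where g = "\<lambda>w. - grad_y J (u, w)" and L = L and \<nu> = \<nu>])
    show "0 \<le> primal J u - J (u, w)" for w using le_primal[of u w] by simp
    show "primal J u - J (u, w) \<le> primal J u - J (u, v) + - grad_y J (u, v) \<bullet> (w - v)
            + L * (norm (w - v))\<^sup>2" for v w
      using taylor_y[of u w v] by (simp add: abs_le_iff)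
    show "2 * \<nu> * (primal J u - J (u, w)) \<le> (norm (- grad_y J (u, w)))\<^sup>2" for w
      using PL by simp
  qed (use cont nu_pos L_pos in auto)
  then show thesis by (auto intro: that)
qed

text \<open>Substitute for a Lipschitz selection of maximisers, which need not be unique: at
  \<open>(v, y)\<close> the partial gradient is at most \<open>L * norm (v - u)\<close> because it
  vanishes at \<open>(u, y)\<close>, and the error bound turns this into a distance.\<close>

lemma near_maximizer_shift:
  assumes "J (u, y) = primal J u"
  obtains w where "J (v, w) = primal J v" "norm (w - y) \<le> 2 * \<kappa> * norm (v - u)"
proof -
  obtain w where w: "J (v, w) = primal J v" "norm (w - y) \<le> 2 / \<nu> * norm (grad_y J (v, y))"
    using near_maximizer .
  have "norm (grad_y J (v, y)) \<le> L * norm (v - u)"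
    using grad_y_diff_le[of "(v, y)" "(u, y)"] grad_y_maximizer[OF assms] by (simp add: norm_Pair)
  then have "2 / \<nu> * norm (grad_y J (v, y)) \<le> 2 / \<nu> * (L * norm (v - u))"
    using nu_pos by (intro mult_left_mono) auto
  with w that show thesis by (simp add: kappa)
qed

lemma grad_x_maximizer_shift:
  assumes "norm (w - y) \<le> 2 * \<kappa> * norm (v - u)"
  shows "norm (grad_x J (v, w) - grad_x J (u, y)) \<le> L * (1 + 2 * \<kappa>) * norm (v - u)"
proof -
  have "norm (grad_x J (v, w) - grad_x J (u, y)) \<le> L * norm (v - u, w - y)"
    using grad_x_diff_le[of "(v, w)" "(u, y)"] by simp
  also have "\<dots> \<le> L * (norm (v - u) + 2 * \<kappa> * norm (v - u))"
    using norm_Pair_le[of "v - u" "w - y"] assms L_pos by (intro mult_left_mono) auto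
  finally show ?thesis by (simp add: algebra_simps)
qed

text \<open>Two comparisons with suboptimal points: \<open>y\<close> competes at \<open>v\<close>,
  which bounds \<open>primal J v\<close> from below, and a maximiser \<open>w\<close> at
  \<open>v\<close> competes at \<open>u\<close>, which bounds it from above up to the change of
  \<open>grad_x J\<close> between the maximisers. As \<open>y\<close> is arbitrary among the
  maximisers at \<open>u\<close>, \<open>grad_x J\<close> must agree on all of them.\<close>

lemma taylor_primal_maximizer:
  assumes y: "J (u, y) = primal J u"
  shows "\<bar>primal J v - primal J u - grad_x J (u, y) \<bullet> (v - u)\<bar> \<le> smoothness * (norm (v - u))\<^sup>2"
proof -
  define n where "n = norm (v - u)"
  obtain w where w: "J (v, w) = primal J v" "norm (w - y) \<le> 2 * \<kappa> * norm (v - u)"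
    using near_maximizer_shift[OF y] .
  have "primal J u + grad_x J (u, y) \<bullet> (v - u) - L * n\<^sup>2 \<le> J (v, y)"
    using taylor_x[of v y u] y by (simp add: abs_le_iff n_def)
  also have "\<dots> \<le> primal J v" by (rule le_primal)
  finally have lower: "- (L * n\<^sup>2) \<le> primal J v - primal J u - grad_x J (u, y) \<bullet> (v - u)" by simp
  have "J (v, w) + grad_x J (v, w) \<bullet> (u - v) - L * n\<^sup>2 \<le> J (u, w)"
    using taylor_x[of u w v] by (simp add: abs_le_iff n_def norm_minus_commute)
  also have "\<dots> \<le> primal J u" by (rule le_primal)
  finally have "primal J v - primal J u - grad_x J (u, y) \<bullet> (v - u)
      \<le> (grad_x J (v, w) - grad_x J (u, y)) \<bullet> (v - u) + L * n\<^sup>2"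
    by (simp add: w inner_diff_left inner_diff_right)
  also have "\<dots> \<le> L * (1 + 2 * \<kappa>) * n * n + L * n\<^sup>2"
    using order_trans[OF norm_cauchy_schwarz mult_right_mono[OF grad_x_maximizer_shift[OF w(2)]]]
    by (simp add: n_def)
  finally have "primal J v - primal J u - grad_x J (u, y) \<bullet> (v - u) \<le> smoothness * n\<^sup>2"
    by (simp add: smoothness_def algebra_simps power2_eq_square)
  moreover have "L * n\<^sup>2 \<le> smoothness * n\<^sup>2"
    unfolding smoothness_def using L_pos kappa_pos by (intro mult_right_mono) auto
  ultimately show ?thesis using lower unfolding n_def by (simp add: abs_le_iff)
qed

lemma GDERIV_primal_maximizer:
  assumes "J (u, y) = primal J u"
  shows "GDERIV (primal J) u :> grad_x J (u, y)"
  unfolding gderiv_def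
proof (rule has_derivativeI_sandwich[where e = 1 and H = "\<lambda>v. smoothness * norm (v - u)"])
  show "bounded_linear (\<lambda>h. h \<bullet> grad_x J (u, y))" by (rule bounded_linear_inner_left)
  show "((\<lambda>v. smoothness * norm (v - u)) \<longlongrightarrow> 0) (at u)"
    by (auto intro!: tendsto_eq_intros)
  fix v assume "v \<noteq> u"
  then show "norm (primal J v - primal J u - (v - u) \<bullet> grad_x J (u, y)) / norm (v - u)
      \<le> smoothness * norm (v - u)"
    using taylor_primal_maximizer[OF assms, of v]
    by (simp add: inner_commute divide_le_eq power2_eq_square mult_ac)
qed simp

lemma grad_primal_maximizer: "J (u, y) = primal J u \<Longrightarrow> grad (primal J) u = grad_x J (u, y)"
  by (rule grad_eqI[OF GDERIV_primal_maximizer])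

lemma GDERIV_primal: "GDERIV (primal J) u :> grad (primal J) u"
  by (metis GDERIV_primal_maximizer grad_primal_maximizer primal_attained)

lemma taylor_primal:
  "\<bar>primal J v - primal J u - grad (primal J) u \<bullet> (v - u)\<bar> \<le> smoothness * (norm (v - u))\<^sup>2"
  by (metis taylor_primal_maximizer grad_primal_maximizer primal_attained)

lemma grad_primal_lipschitz: "smoothness-lipschitz_on UNIV (grad (primal J))"
proof (rule lipschitz_onI)
  fix v u
  obtain y where y: "J (u, y) = primal J u" using primal_attained .
  obtain w where w: "J (v, w) = primal J v" "norm (w - y) \<le> 2 * \<kappa> * norm (v - u)"
    using near_maximizer_shift[OF y] .
  have "norm (grad (primal J) v - grad (primal J) u) \<le> L * (1 + 2 * \<kappa>) * norm (v - u)"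
    unfolding grad_primal_maximizer[OF y] grad_primal_maximizer[OF w(1)]
    by (rule grad_x_maximizer_shift[OF w(2)])
  also have "\<dots> \<le> smoothness * norm (v - u)"
    unfolding smoothness_def using L_pos by (intro mult_right_mono) auto
  finally show "dist (grad (primal J) v) (grad (primal J) u) \<le> smoothness * dist v u"
    by (simp add: dist_norm)
qed (use smoothness_pos in simp)

lemma grad_x_primal_diff_le:
  "norm (grad_x J (u, y) - grad (primal J) u) \<le> 2 * \<kappa> * norm (grad_y J (u, y))"
proof -
  obtain w where w: "J (u, w) = primal J u" "norm (w - y) \<le> 2 / \<nu> * norm (grad_y J (u, y))"
    using near_maximizer .
  have "norm (grad_x J (u, y) - grad (primal J) u) \<le> L * norm (w - y)"
    using grad_x_diff_le[of "(u, y)" "(u, w)"] grad_primal_maximizer[OF w(1)]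
    by (simp add: norm_Pair norm_minus_commute)
  also have "\<dots> \<le> L * (2 / \<nu> * norm (grad_y J (u, y)))"
    using w(2) L_pos by (intro mult_left_mono) auto
  finally show ?thesis by (simp add: kappa mult_ac)
qed

text \<open>Descent counterpart of \<open>norm_grad_y_le\<close>, with a lower bound
  \<open>B\<close> in the role of the extremum. It serves the integrability of the initial
  gradient.\<close>

lemma norm_grad_primal_le:
  assumes "\<And>v. B \<le> primal J v"
  shows "(norm (grad (primal J) u))\<^sup>2 \<le> 4 * smoothness * (primal J u - B)"
proof -
  define g where "g = grad (primal J) u"
  define t where "t = 1 / (2 * smoothness)"
  have "B \<le> primal J (u - t *\<^sub>R g)" by (rule assms)
  also have "\<dots> \<le> primal J u - t * (norm g)\<^sup>2 + smoothness * (t\<^sup>2 * (norm g)\<^sup>2)"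
    using taylor_primal[of "u - t *\<^sub>R g" u]
    by (simp add: g_def[symmetric] dot_square_norm power_mult_distrib abs_le_iff)
  also have "smoothness * (t\<^sup>2 * (norm g)\<^sup>2) = t * (norm g)\<^sup>2 / 2"
    using smoothness_pos by (simp add: t_def power2_eq_square)
  finally have "t * (norm g)\<^sup>2 \<le> 2 * (primal J u - B)" by simp
  then have "2 * smoothness * (t * (norm g)\<^sup>2) \<le> 2 * smoothness * (2 * (primal J u - B))"
    using smoothness_pos by (intro mult_left_mono) auto
  then show ?thesis
    using smoothness_pos by (simp add: g_def[symmetric] t_def algebra_simps)
qed

text \<open>This is \<open>primal J\<close> plus the nonnegative gap
  \<open>primal J u - J (u, y)\<close>. The weight 2 is there because the step in the first block
  also lowers \<open>J\<close> and may widen the gap: one copy of \<open>primal J\<close> pays for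
  that, the other supplies the descent.\<close>

definition lyapunov :: "'a \<times> 'b \<Rightarrow> real" where
  "lyapunov z = 2 * primal J (fst z) - J z"

lemma primal_le_lyapunov: "primal J (fst z) \<le> lyapunov z"
  using le_primal[of "fst z" "snd z"] by (simp add: lyapunov_def)

lemma lyapunov_step:
  fixes z m :: "'a \<times> 'b" and \<mu>x \<mu>y :: real
  defines "z' \<equiv> z + (- (\<mu>x *\<^sub>R (fst m /\<^sub>R norm (fst m))), \<mu>y *\<^sub>R (snd m /\<^sub>R norm (snd m)))"
  assumes \<mu>x: "0 \<le> \<mu>x" "6 * \<kappa> * \<mu>x \<le> \<mu>y" and \<mu>y: "0 \<le> \<mu>y"
  shows "\<mu>x * norm (grad (primal J) (fst z)) \<le> lyapunov z - lyapunov z'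
           + 2 * (\<mu>x + \<mu>y) * norm (m - grad J z) + (2 * smoothness + L) * (\<mu>x\<^sup>2 + \<mu>y\<^sup>2)"
proof -
  obtain u y where z: "z = (u, y)" by (cases z)
  obtain mx my where m: "m = (mx, my)" by (cases m)
  define dx where "dx = - (\<mu>x *\<^sub>R (mx /\<^sub>R norm mx))"
  define dy where "dy = \<mu>y *\<^sub>R (my /\<^sub>R norm my)"
  define gP where "gP = grad (primal J) u"
  define gx where "gx = grad_x J z"
  define gy where "gy = grad_y J z"
  define E where "E = norm (m - grad J z)"
  have z': "z' = (u + dx, y + dy)" by (simp add: z'_def z m dx_def dy_def)
  have gz: "grad J z = (gx, gy)" by (simp add: gx_def gy_def grad_x_def grad_y_def)
  have ndx: "norm dx \<le> \<mu>x" and ndy: "norm dy \<le> \<mu>y"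
    unfolding dx_def dy_def norm_minus_cancel norm_scaleR[of \<mu>x] norm_scaleR[of \<mu>y]
    using \<mu>x(1) \<mu>y by (simp_all only: abs_of_nonneg mult_right_le_one_le norm_normalized_le norm_ge_zero)
  have ex: "norm (mx - gx) \<le> E" and ey: "norm (my - gy) \<le> E"
    using norm_fst_le[of "mx - gx" "my - gy"] norm_snd_le[of "my - gy" "mx - gx"]
    by (auto simp: E_def m gz)
  have P_step: "primal J (u + dx) - primal J u \<le> gP \<bullet> dx + smoothness * \<mu>x\<^sup>2"
  proof -
    have "smoothness * (norm dx)\<^sup>2 \<le> smoothness * \<mu>x\<^sup>2"
      using ndx smoothness_pos by (intro mult_left_mono power_mono) auto
    then show ?thesis using taylor_primal[of "u + dx" u] by (simp add: gP_def abs_le_iff)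
  qed
  have J_step: "J z - J z' \<le> - (gx \<bullet> dx) - gy \<bullet> dy + L * (\<mu>x\<^sup>2 + \<mu>y\<^sup>2)"
  proof -
    have "(norm (dx, dy))\<^sup>2 = (norm dx)\<^sup>2 + (norm dy)\<^sup>2" by (simp add: norm_Pair)
    also have "\<dots> \<le> \<mu>x\<^sup>2 + \<mu>y\<^sup>2"
      using ndx ndy by (intro add_mono power_mono) auto
    finally have "L * (norm (dx, dy))\<^sup>2 \<le> L * (\<mu>x\<^sup>2 + \<mu>y\<^sup>2)"
      using L_pos by (intro mult_left_mono) auto
    then show ?thesis
      using taylor_J[of z' z] unfolding z' z gz[unfolded z] by (simp add: abs_le_iff)
  qed
  have diff: "norm (gP - gx) \<le> 2 * \<kappa> * norm gy"
    using grad_x_primal_diff_le[of u y]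
    by (simp add: gP_def gx_def gy_def z norm_minus_commute)
  \<comment> \<open>The block \<open>mx\<close> estimates \<open>gx\<close>, not \<open>gP\<close>;
    measuring it against \<open>gP\<close> adds \<open>2 * \<kappa> * norm gy\<close> to its error,
    which the factor 2 of \<open>inner_normalized_ge\<close> doubles.\<close>
  have "gP \<bullet> dx \<le> - \<mu>x * norm gP + \<mu>x * (2 * norm (mx - gP))"
    using mult_left_mono[OF inner_normalized_ge[of gP mx] \<mu>x(1)] by (simp add: dx_def algebra_simps)
  also have "\<dots> \<le> - \<mu>x * norm gP + \<mu>x * (2 * (E + 2 * \<kappa> * norm gy))"
  proof -
    have "norm (mx - gP) \<le> norm (mx - gx) + norm (gP - gx)"
      using norm_triangle_ineq4[of "mx - gx" "gP - gx"] by simp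
    also have "\<dots> \<le> E + 2 * \<kappa> * norm gy" using ex diff by simp
    finally show ?thesis using \<mu>x by (intro add_left_mono mult_left_mono) auto
  qed
  finally have i1: "gP \<bullet> dx \<le> - \<mu>x * norm gP + \<mu>x * (2 * (E + 2 * \<kappa> * norm gy))" .
  have i2: "(gP - gx) \<bullet> dx \<le> (2 * \<kappa> * norm gy) * \<mu>x"
    using diff ndx kappa_pos by (intro order_trans[OF norm_cauchy_schwarz] mult_mono) auto
  have "- (gy \<bullet> dy) \<le> - \<mu>y * norm gy + \<mu>y * (2 * norm (my - gy))"
    using mult_left_mono[OF inner_normalized_ge[of gy my] \<mu>y] by (simp add: dy_def algebra_simps)
  also have "\<dots> \<le> - \<mu>y * norm gy + \<mu>y * (2 * E)"
    using ey \<mu>y by (intro add_left_mono mult_left_mono) auto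
  finally have i3: "- (gy \<bullet> dy) \<le> - \<mu>y * norm gy + \<mu>y * (2 * E)" .
  \<comment> \<open>Origin of the 6 in the stability condition: 4 from the descent along
    \<open>mx\<close> and 2 from the mismatch between \<open>gP\<close> and \<open>gx\<close>. The
    ascent in the second block gains \<open>\<mu>y * norm gy\<close>, which absorbs both.\<close>
  have i4: "6 * \<kappa> * \<mu>x * norm gy \<le> \<mu>y * norm gy"
    by (rule mult_right_mono[OF \<mu>x(2)]) simp
  have i5: "0 \<le> smoothness * \<mu>y\<^sup>2" using smoothness_pos by simp
  \<comment> \<open>Here \<open>a\<close>, \<open>b\<close>, \<open>c\<close> stand for
    \<open>gP \<bullet> dx\<close>, \<open>gx \<bullet> dx\<close>, \<open>gy \<bullet> dy\<close>;
    the rearrangement displays one full copy of the descent and the mismatch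
    \<open>a - b\<close>.\<close>
  have combine: "d \<le> a + (a - b) - c + 2 * s + l"
    if "d = 2 * p + q" "p \<le> a + s" "q \<le> - b - c + l" for a b c d l p q s :: real
    using that by linarith
  have "lyapunov z' - lyapunov z = 2 * (primal J (u + dx) - primal J u) + (J z - J z')"
    unfolding lyapunov_def z z' fst_conv by (simp only: algebra_simps)
  from combine[OF this P_step J_step] have step: "lyapunov z' - lyapunov z \<le> gP \<bullet> dx + (gP - gx) \<bullet> dx - gy \<bullet> dy
      + 2 * (smoothness * \<mu>x\<^sup>2) + L * (\<mu>x\<^sup>2 + \<mu>y\<^sup>2)"
    by (simp only: inner_diff_left)
  define a where "a = \<kappa> * \<mu>x * norm gy"
  have a1: "\<mu>x * (2 * (E + 2 * \<kappa> * norm gy)) = 2 * (\<mu>x * E) + 4 * a"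
    by (simp add: a_def distrib_left)
  have a2: "(2 * \<kappa> * norm gy) * \<mu>x = 2 * a" and a4: "6 * \<kappa> * \<mu>x * norm gy = 6 * a"
    by (simp_all add: a_def)
  have "\<mu>x * norm gP \<le> lyapunov z - lyapunov z' + (2 * (\<mu>x * E) + 2 * (\<mu>y * E))
      + (2 * (smoothness * \<mu>x\<^sup>2) + 2 * (smoothness * \<mu>y\<^sup>2) + L * (\<mu>x\<^sup>2 + \<mu>y\<^sup>2))"
    using step i1[unfolded a1] i2[unfolded a2] i3 i4[unfolded a4] i5 by linarith
  also have "(2 * (\<mu>x * E) + 2 * (\<mu>y * E)) = 2 * (\<mu>x + \<mu>y) * E"
    by (simp add: algebra_simps)
  also have "2 * (smoothness * \<mu>x\<^sup>2) + 2 * (smoothness * \<mu>y\<^sup>2) + L * (\<mu>x\<^sup>2 + \<mu>y\<^sup>2)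
      = (2 * smoothness + L) * (\<mu>x\<^sup>2 + \<mu>y\<^sup>2)"
    by (simp add: algebra_simps)
  finally show ?thesis by (simp add: gP_def E_def z)
qed

end

section \<open>Conditional means and independence\<close>

text \<open>Measurability is given only for each vector \<open>u\<close>. The inequality
  \<open>norm (H \<omega> u) \<le> a * norm u\<close> is closed in \<open>u\<close>, so it suffices
  on a countable dense set, and the sublevel sets of the norm become countable
  intersections.\<close>

lemma borel_measurable_norm_blinfun:
  fixes H :: "'w \<Rightarrow> 'a::euclidean_space \<Rightarrow>\<^sub>L 'b::euclidean_space"
  assumes [measurable]: "\<And>u. (\<lambda>\<omega>. H \<omega> u) \<in> borel_measurable M"
  shows "(\<lambda>\<omega>. norm (H \<omega>)) \<in> borel_measurable M"
  unfolding borel_measurable_iff_le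
proof
  fix a
  obtain D :: "'a set" where D: "countable D"
    and dense: "\<And>X. open X \<Longrightarrow> X \<noteq> {} \<Longrightarrow> \<exists>d\<in>D. d \<in> X"
    by (rule countable_dense_setE) blast
  have closure_D: "closure D = UNIV"
    unfolding closure_approachable set_eq_iff using dense[OF open_ball]
    by (auto simp: dist_commute)
  show "{\<omega> \<in> space M. norm (H \<omega>) \<le> a} \<in> sets M"
  proof (cases "a \<ge> 0")
    case True
    have "norm B \<le> a \<longleftrightarrow> (\<forall>u\<in>D. norm (blinfun_apply B u) \<le> a * norm u)"
      for B :: "'a \<Rightarrow>\<^sub>L 'b"
    proof
      assume "norm B \<le> a"
      then show "\<forall>u\<in>D. norm (blinfun_apply B u) \<le> a * norm u"
        by (meson mult_right_mono norm_blinfun norm_ge_zero order_trans)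
    next
      assume *: "\<forall>u\<in>D. norm (blinfun_apply B u) \<le> a * norm u"
      have "closed {u. norm (blinfun_apply B u) \<le> a * norm u}"
        by (intro closed_Collect_le continuous_intros)
      with * have "closure D \<subseteq> {u. norm (blinfun_apply B u) \<le> a * norm u}"
        by (intro closure_minimal) auto
      then show "norm B \<le> a"
        using True by (intro norm_blinfun_bound) (auto simp: closure_D)
    qed
    moreover have "D \<noteq> {}" using dense[of UNIV] by auto
    then have "(\<Inter>u\<in>D. {\<omega> \<in> space M. norm (blinfun_apply (H \<omega>) u) \<le> a * norm u}) \<in> sets M"
      using D by (intro sets.countable_INT') auto
    moreover have "(\<Inter>u\<in>D. {\<omega> \<in> space M. norm (blinfun_apply (H \<omega>) u) \<le> a * norm u})
        = {\<omega> \<in> space M. \<forall>u\<in>D. norm (blinfun_apply (H \<omega>) u) \<le> a * norm u}"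
      using \<open>D \<noteq> {}\<close> by blast
    ultimately show ?thesis by simp
  next
    case False
    then have "{\<omega> \<in> space M. norm (H \<omega>) \<le> a} = {}"
      by (auto simp: not_le intro: less_le_trans[OF _ norm_ge_zero])
    then show ?thesis by (simp only: sets.empty_sets)
  qed
qed

text \<open>The Hessian noise is centred for each fixed vector, while the algorithm applies it to a
  random one. This expansion reduces the latter to fixed basis vectors with random scalar
  coefficients.\<close>

lemma blinfun_apply_basis_sum:
  "blinfun_apply A v = (\<Sum>b\<in>Basis. (v \<bullet> b) *\<^sub>R blinfun_apply A b)"
  for A :: "'a::euclidean_space \<Rightarrow>\<^sub>L 'b::real_normed_vector"
  by (subst euclidean_representation[of v, symmetric])
    (simp only: blinfun.sum_right blinfun.scaleR_right)

lemma borel_measurable_blinfun_apply: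
  fixes H :: "'w \<Rightarrow> 'a::euclidean_space \<Rightarrow>\<^sub>L 'b::euclidean_space"
  assumes [measurable]: "\<And>u. (\<lambda>\<omega>. H \<omega> u) \<in> borel_measurable M" "v \<in> borel_measurable M"
  shows "(\<lambda>\<omega>. H \<omega> (v \<omega>)) \<in> borel_measurable M"
  by (subst blinfun_apply_basis_sum) measurable

lemma (in prob_space) cond_second_moment_le:
  fixes f :: "'a \<Rightarrow> real"
  assumes "subalgebra M F" and [measurable]: "f \<in> borel_measurable M"
    and nonneg: "\<And>\<omega>. f \<omega> \<ge> 0" "c \<ge> 0"
    and le: "AE \<omega> in M. nn_cond_exp M F (\<lambda>\<omega>. ennreal (f \<omega>)) \<omega> \<le> ennreal c"
  shows "integrable M f" "(\<integral>\<omega>. f \<omega> \<partial>M) \<le> c"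
proof -
  interpret finite_measure_subalgebra M F by standard fact
  have "(\<integral>\<^sup>+\<omega>. ennreal (f \<omega>) \<partial>M) = (\<integral>\<^sup>+\<omega>. nn_cond_exp M F (\<lambda>\<omega>. ennreal (f \<omega>)) \<omega> \<partial>M)"
    using nn_cond_exp_intg[of "\<lambda>_. 1" "\<lambda>\<omega>. ennreal (f \<omega>)"] by simp
  also have "\<dots> \<le> (\<integral>\<^sup>+\<omega>. ennreal c \<partial>M)"
    using le by (rule nn_integral_mono_AE)
  also have "\<dots> = ennreal c" by (simp add: emeasure_space_1)
  finally have nn: "(\<integral>\<^sup>+\<omega>. ennreal (f \<omega>) \<partial>M) \<le> ennreal c" .
  then show int: "integrable M f"
    using nonneg by (intro integrableI_nonneg) (auto simp: le_less_trans)
  show "(\<integral>\<omega>. f \<omega> \<partial>M) \<le> c"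
    using nn nonneg by (subst (asm) nn_integral_eq_integral[OF int]) auto
qed

text \<open>The coordinates of \<open>g\<close> are integrable because they agree almost everywhere
  with conditional expectations. Test functions bounded by 1 are enough, as the later argument tests
  with a sign.\<close>

lemma (in prob_space) has_cond_exp_centred:
  fixes f g :: "'a \<Rightarrow> 'b::euclidean_space"
  assumes "subalgebra M F" and ce: "has_cond_exp M F f g"
    and [measurable]: "g \<in> borel_measurable M" and b: "b \<in> Basis"
  shows "integrable M (\<lambda>\<omega>. (f \<omega> - g \<omega>) \<bullet> b)"
    and "\<lbrakk>s \<in> borel_measurable F; \<And>\<omega>. \<bar>s \<omega>\<bar> \<le> (1::real)\<rbrakk> \<Longrightarrow> (\<integral>\<omega>. s \<omega> * ((f \<omega> - g \<omega>) \<bullet> b) \<partial>M) = 0"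
proof -
  interpret finite_measure_subalgebra M F by standard fact
  have intf: "integrable M (\<lambda>\<omega>. f \<omega> \<bullet> b)"
    using ce by (auto simp: has_cond_exp_def)
  have ae: "AE \<omega> in M. real_cond_exp M F (\<lambda>\<omega>. f \<omega> \<bullet> b) \<omega> = g \<omega> \<bullet> b"
    using ce b by (auto simp: has_cond_exp_def)
  have intg: "integrable M (\<lambda>\<omega>. g \<omega> \<bullet> b)"
    using real_cond_exp_int(1)[OF intf] ae by (subst (asm) integrable_cong_AE) auto
  show "integrable M (\<lambda>\<omega>. (f \<omega> - g \<omega>) \<bullet> b)"
    unfolding inner_diff_left using intf intg by (rule Bochner_Integration.integrable_diff)
  assume s: "s \<in> borel_measurable F" and bound: "\<And>\<omega>. \<bar>s \<omega>\<bar> \<le> 1"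
  then have [measurable]: "s \<in> borel_measurable M"
    using measurable_from_subalg[OF subalg] by blast
  have bounded_mult: "integrable M (\<lambda>\<omega>. s \<omega> * r \<omega>)" if r: "integrable M r" for r :: "'a \<Rightarrow> real"
    using r by (rule Bochner_Integration.integrable_bound)
      (use bound r in \<open>auto simp: abs_mult intro!: mult_left_le_one_le\<close>)
  note intsf = bounded_mult[OF intf] and intsg = bounded_mult[OF intg]
  have "(\<integral>\<omega>. s \<omega> * (f \<omega> \<bullet> b) \<partial>M) = (\<integral>\<omega>. s \<omega> * real_cond_exp M F (\<lambda>\<omega>. f \<omega> \<bullet> b) \<omega> \<partial>M)"
    using intsf s intf by (intro real_cond_exp_intg(2)[symmetric]) auto
  also have "\<dots> = (\<integral>\<omega>. s \<omega> * (g \<omega> \<bullet> b) \<partial>M)"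
    using ae by (intro integral_cong_AE) auto
  finally show "(\<integral>\<omega>. s \<omega> * ((f \<omega> - g \<omega>) \<bullet> b) \<partial>M) = 0"
    unfolding inner_diff_left right_diff_distrib
    by (subst Bochner_Integration.integral_diff[OF intsf intsg]) simp
qed

definition (in prob_space) independent_of :: "'a measure \<Rightarrow> 's measure \<Rightarrow> ('a \<Rightarrow> 's) \<Rightarrow> bool" where
  "independent_of F S X \<longleftrightarrow> subalgebra M F \<and> X \<in> M \<rightarrow>\<^sub>M S \<and>
     (\<forall>A\<in>sets F. \<forall>B\<in>sets S. prob (A \<inter> (X -` B \<inter> space M)) = prob A * prob (X -` B \<inter> space M))"

lemma (in prob_space) distr_Pair_independent_of:
  assumes indep: "independent_of F S X" and U: "U \<in> F \<rightarrow>\<^sub>M N"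
  shows "distr M N U \<Otimes>\<^sub>M distr M S X = distr M (N \<Otimes>\<^sub>M S) (\<lambda>\<omega>. (U \<omega>, X \<omega>))"
proof -
  have F: "subalgebra M F" and X[measurable]: "X \<in> M \<rightarrow>\<^sub>M S"
    using indep by (auto simp: independent_of_def)
  have UM[measurable]: "U \<in> M \<rightarrow>\<^sub>M N" by (rule measurable_from_subalg[OF F U])
  interpret U: prob_space "distr M N U" by (rule prob_space_distr) (rule UM)
  interpret X: prob_space "distr M S X" by (rule prob_space_distr) (rule X)
  show ?thesis
  proof (rule pair_measure_eqI)
    fix A B assume "A \<in> sets (distr M N U)" "B \<in> sets (distr M S X)"
    then have A[measurable]: "A \<in> sets N" and B[measurable]: "B \<in> sets S" by simp_all
    have "U -` A \<inter> space M \<in> sets F"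
      using measurable_sets[OF U A] F by (simp add: subalgebra_def)
    then have "prob ((U -` A \<inter> space M) \<inter> (X -` B \<inter> space M))
        = prob (U -` A \<inter> space M) * prob (X -` B \<inter> space M)"
      using indep B by (auto simp: independent_of_def)
    moreover have "(\<lambda>\<omega>. (U \<omega>, X \<omega>)) -` (A \<times> B) \<inter> space M
        = (U -` A \<inter> space M) \<inter> (X -` B \<inter> space M)" by auto
    ultimately show "emeasure (distr M N U) A * emeasure (distr M S X) B
        = emeasure (distr M (N \<Otimes>\<^sub>M S) (\<lambda>\<omega>. (U \<omega>, X \<omega>))) (A \<times> B)"
      by (simp add: emeasure_distr emeasure_eq_measure ennreal_mult)
  qed (auto intro: U.sigma_finite_measure X.sigma_finite_measure)
qed

text \<open>
  The noise is centred given the iterates only, whereas \<open>Y\<close> depends on the whole past. By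
  independence the conditional mean of \<open>q Z X\<close> given the past is a function of \<open>Z\<close>,
  hence it is determined by the mean given \<open>Z\<close>.
\<close>

lemma (in prob_space) centred_noise_orthogonal:
  fixes Z :: "'a \<Rightarrow> 'z::second_countable_topology" and Y :: "'a \<Rightarrow> real"
    and S :: "'s measure" and q :: "'z \<Rightarrow> 's \<Rightarrow> real"
  assumes indep: "independent_of F S X"
    and Z: "Z \<in> borel_measurable F" and Y: "Y \<in> borel_measurable F"
    and q[measurable]: "case_prod q \<in> borel_measurable (borel \<Otimes>\<^sub>M S)"
    and int: "integrable M (\<lambda>\<omega>. q (Z \<omega>) (X \<omega>))"
    and int_Y: "integrable M (\<lambda>\<omega>. Y \<omega> * q (Z \<omega>) (X \<omega>))"
    and centred: "\<And>s. \<lbrakk>s \<in> borel_measurable borel; \<And>z. \<bar>s z\<bar> \<le> (1::real)\<rbrakk>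
                    \<Longrightarrow> (\<integral>\<omega>. s (Z \<omega>) * q (Z \<omega>) (X \<omega>) \<partial>M) = 0"
  shows "(\<integral>\<omega>. Y \<omega> * q (Z \<omega>) (X \<omega>) \<partial>M) = 0"
proof -
  have F: "subalgebra M F" and X[measurable]: "X \<in> M \<rightarrow>\<^sub>M S"
    using indep by (auto simp: independent_of_def)
  have [measurable]: "Z \<in> borel_measurable M" "Y \<in> borel_measurable M"
    using measurable_from_subalg[OF F Z] measurable_from_subalg[OF F Y] .
  have ZY: "(\<lambda>\<omega>. (Z \<omega>, Y \<omega>)) \<in> M \<rightarrow>\<^sub>M borel \<Otimes>\<^sub>M borel" by measurable
  have distr: "distr M (borel \<Otimes>\<^sub>M borel) (\<lambda>\<omega>. (Z \<omega>, Y \<omega>)) \<Otimes>\<^sub>M distr M S X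
      = distr M ((borel \<Otimes>\<^sub>M borel) \<Otimes>\<^sub>M S) (\<lambda>\<omega>. ((Z \<omega>, Y \<omega>), X \<omega>))"
    using indep by (rule distr_Pair_independent_of) (use Z Y in measurable)
  define D where "D = distr M (borel \<Otimes>\<^sub>M borel) (\<lambda>\<omega>. (Z \<omega>, Y \<omega>))"
  define DX where "DX = distr M S X"
  have [measurable_cong]: "sets D = sets (borel \<Otimes>\<^sub>M borel)" "sets DX = sets S"
    by (simp_all add: D_def DX_def)
  interpret D: prob_space D unfolding D_def by (rule prob_space_distr) (rule ZY)
  interpret DX: prob_space DX unfolding DX_def by (rule prob_space_distr) (rule X)
  interpret pair_sigma_finite D DX ..
  define h where "h z = (\<integral>s. q z s \<partial>DX)" for z
  have [measurable]: "h \<in> borel_measurable borel"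
    unfolding h_def by (rule DX.borel_measurable_lebesgue_integral) simp
  \<comment> \<open>Applied twice: with the sign of \<open>h\<close> to show that \<open>h\<close>
    vanishes, and with \<open>r z y = y\<close> for the claim itself.\<close>
  have fubini:
    "integrable D (\<lambda>p. r (fst p) (snd p) * h (fst p))"
    "(\<integral>\<omega>. r (Z \<omega>) (Y \<omega>) * q (Z \<omega>) (X \<omega>) \<partial>M) = (\<integral>p. r (fst p) (snd p) * h (fst p) \<partial>D)"
    if [measurable]: "case_prod r \<in> borel_measurable (borel \<Otimes>\<^sub>M borel)"
      and r: "integrable M (\<lambda>\<omega>. r (Z \<omega>) (Y \<omega>) * q (Z \<omega>) (X \<omega>))" for r :: "'z \<Rightarrow> real \<Rightarrow> real"
  proof -
    let ?f = "\<lambda>w. r (fst (fst w)) (snd (fst w)) * q (fst (fst w)) (snd w)"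
    have f[measurable]: "?f \<in> borel_measurable ((borel \<Otimes>\<^sub>M borel) \<Otimes>\<^sub>M S)"
      by measurable
    have prod: "integrable (D \<Otimes>\<^sub>M DX) ?f"
      unfolding D_def DX_def distr using r by (subst integrable_distr_eq) auto
    show "integrable D (\<lambda>p. r (fst p) (snd p) * h (fst p))"
      using integrable_fst'[OF prod] by (simp add: h_def)
    have "(\<integral>\<omega>. r (Z \<omega>) (Y \<omega>) * q (Z \<omega>) (X \<omega>) \<partial>M) = (\<integral>w. ?f w \<partial>(D \<Otimes>\<^sub>M DX))"
      unfolding D_def DX_def distr by (subst integral_distr) auto
    also have "\<dots> = (\<integral>p. r (fst p) (snd p) * h (fst p) \<partial>D)"
      using integral_fst'[OF prod] by (simp add: h_def)
    finally show "(\<integral>\<omega>. r (Z \<omega>) (Y \<omega>) * q (Z \<omega>) (X \<omega>) \<partial>M) = (\<integral>p. r (fst p) (snd p) * h (fst p) \<partial>D)" .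
  qed
  \<comment> \<open>Testing the centring with the sign of \<open>h\<close> makes the integral of the
    absolute value of \<open>h\<close> zero, so \<open>h\<close> vanishes almost surely under the
    law of \<open>Z\<close>.\<close>
  have sgn_int: "integrable M (\<lambda>\<omega>. sgn (h (Z \<omega>)) * q (Z \<omega>) (X \<omega>))"
    using int by (rule Bochner_Integration.integrable_bound) (auto simp: abs_mult abs_sgn_eq)
  have "(\<integral>\<omega>. sgn (h (Z \<omega>)) * q (Z \<omega>) (X \<omega>) \<partial>M) = 0"
    by (rule centred) (auto simp: abs_sgn_eq)
  then have "(\<integral>p. \<bar>h (fst p)\<bar> \<partial>D) = 0"
    using fubini(2)[of "\<lambda>z _. sgn (h z)"] sgn_int by (simp add: linordered_idom_class.abs_sgn mult.commute)
  moreover have "integrable D (\<lambda>p. \<bar>h (fst p)\<bar>)"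
    using fubini(1)[of "\<lambda>z _. sgn (h z)"] sgn_int by (simp add: linordered_idom_class.abs_sgn mult.commute)
  ultimately have "AE p in D. h (fst p) = 0"
    by (subst (asm) integral_nonneg_eq_0_iff_AE) auto
  then have "(\<integral>p. snd p * h (fst p) \<partial>D) = (\<integral>p. 0 \<partial>D)"
    by (intro integral_cong_AE) auto
  then show ?thesis
    using fubini(2)[of "\<lambda>_ y. y"] int_Y by simp
qed

lemma abs_inner_mult_le:
  fixes v w :: "'a::euclidean_space"
  assumes "b \<in> Basis"
  shows "\<bar>(v \<bullet> b) * (w \<bullet> b)\<bar> \<le> (norm v)\<^sup>2 + (norm w)\<^sup>2"
proof -
  have "\<bar>(v \<bullet> b) * (w \<bullet> b)\<bar> \<le> norm v * norm w"
    unfolding abs_mult using assms by (intro mult_mono Basis_le_norm) auto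
  also have "\<dots> \<le> 2 * norm v * norm w" by simp
  also have "\<dots> \<le> (norm v)\<^sup>2 + (norm w)\<^sup>2" by (rule sum_squares_bound)
  finally show ?thesis .
qed

lemma (in prob_space) centred_noise_inner_orthogonal:
  fixes Z :: "'a \<Rightarrow> 'z::second_countable_topology" and W :: "'a \<Rightarrow> 'v::euclidean_space"
    and S :: "'s measure" and q :: "'z \<Rightarrow> 's \<Rightarrow> 'v"
  assumes indep: "independent_of F S X"
    and Z: "Z \<in> borel_measurable F" and W: "W \<in> borel_measurable F"
    and q[measurable]: "case_prod q \<in> borel_measurable (borel \<Otimes>\<^sub>M S)"
    and int: "\<And>b. b \<in> Basis \<Longrightarrow> integrable M (\<lambda>\<omega>. q (Z \<omega>) (X \<omega>) \<bullet> b)"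
    and sq: "integrable M (\<lambda>\<omega>. (norm (q (Z \<omega>) (X \<omega>)))\<^sup>2)" "integrable M (\<lambda>\<omega>. (norm (W \<omega>))\<^sup>2)"
    and centred: "\<And>s b. \<lbrakk>b \<in> Basis; s \<in> borel_measurable borel; \<And>z. \<bar>s z\<bar> \<le> (1::real)\<rbrakk>
                    \<Longrightarrow> (\<integral>\<omega>. s (Z \<omega>) * (q (Z \<omega>) (X \<omega>) \<bullet> b) \<partial>M) = 0"
  shows "integrable M (\<lambda>\<omega>. W \<omega> \<bullet> q (Z \<omega>) (X \<omega>))" "(\<integral>\<omega>. W \<omega> \<bullet> q (Z \<omega>) (X \<omega>) \<partial>M) = 0"
proof -
  have F: "subalgebra M F" and X[measurable]: "X \<in> M \<rightarrow>\<^sub>M S"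
    using indep by (auto simp: independent_of_def)
  have [measurable]: "Z \<in> borel_measurable M" "W \<in> borel_measurable M"
    using measurable_from_subalg[OF F Z] measurable_from_subalg[OF F W] .
  have int_b: "integrable M (\<lambda>\<omega>. (W \<omega> \<bullet> b) * (q (Z \<omega>) (X \<omega>) \<bullet> b))" if "b \<in> Basis" for b
    using Bochner_Integration.integrable_add[OF sq(2,1)]
  proof (rule Bochner_Integration.integrable_bound)
    show "AE \<omega> in M. norm ((W \<omega> \<bullet> b) * (q (Z \<omega>) (X \<omega>) \<bullet> b))
        \<le> norm ((norm (W \<omega>))\<^sup>2 + (norm (q (Z \<omega>) (X \<omega>)))\<^sup>2)"
      using abs_inner_mult_le[OF that] by (intro AE_I2) (simp only: real_norm_def abs_of_nonneg add_nonneg_nonneg zero_le_power2)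
  qed measurable
  have zero: "(\<integral>\<omega>. (W \<omega> \<bullet> b) * (q (Z \<omega>) (X \<omega>) \<bullet> b) \<partial>M) = 0" if b: "b \<in> Basis" for b
  proof (rule centred_noise_orthogonal[where q = "\<lambda>z s. q z s \<bullet> b", OF indep Z])
    show "(\<lambda>\<omega>. W \<omega> \<bullet> b) \<in> borel_measurable F" using W by measurable
    show "(\<lambda>(z, s). q z s \<bullet> b) \<in> borel_measurable (borel \<Otimes>\<^sub>M S)" by measurable
  qed (use int_b int centred b in auto)
  show "integrable M (\<lambda>\<omega>. W \<omega> \<bullet> q (Z \<omega>) (X \<omega>))"
    by (subst euclidean_inner) (intro Bochner_Integration.integrable_sum int_b)
  show "(\<integral>\<omega>. W \<omega> \<bullet> q (Z \<omega>) (X \<omega>) \<partial>M) = 0"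
    by (subst euclidean_inner) (simp add: Bochner_Integration.integral_sum int_b zero)
qed

section \<open>Sigma-algebras of the iterates and of the samples\<close>

lemma subalgebra_history:
  assumes "\<And>j. j \<le> i \<Longrightarrow> z j \<in> borel_measurable M"
  shows "subalgebra M (history M z i)"
proof -
  have gen: "{z j -` A \<inter> space M | j A. j \<le> i \<and> A \<in> sets borel} \<subseteq> sets M"
    using assms by (auto intro: measurable_sets)
  then have "{z j -` A \<inter> space M | j A. j \<le> i \<and> A \<in> sets borel} \<subseteq> Pow (space M)"
    by (rule order_trans) (rule sets.space_closed)
  then show ?thesis
    unfolding subalgebra_def history_def sets_measure_of using sets.sigma_sets_subset[OF gen]
    by (simp add: space_measure_of_conv)
qed

lemma borel_measurable_history:
  fixes z :: "nat \<Rightarrow> 'w \<Rightarrow> 'z::topological_space"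
  shows "z i \<in> borel_measurable (history M z i)"
proof (rule measurableI)
  fix A :: "'z set" assume "A \<in> sets borel"
  then show "z i -` A \<inter> space (history M z i) \<in> sets (history M z i)"
    unfolding history_def
    by (subst sets_measure_of) (auto simp: space_measure_of_conv)
qed simp

lemma Int_stable_vimage: "Int_stable {f -` A \<inter> \<Omega> | A. A \<in> sets N}"
proof (rule Int_stableI, safe)
  fix A B assume "A \<in> sets N" "B \<in> sets N"
  then show "\<exists>C. f -` A \<inter> \<Omega> \<inter> (f -` B \<inter> \<Omega>) = f -` C \<inter> \<Omega> \<and> C \<in> sets N"
    by (intro exI[of _ "A \<inter> B"]) auto
qed

locale sample_stream = prob_space M
  for M :: "'w measure" and S :: "'s measure" and \<xi> :: "nat \<Rightarrow> 'w \<Rightarrow> 's"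
    and X\<^sub>0 :: "'w \<Rightarrow> 'c::topological_space" +
  assumes samples_indep: "indep_vars (\<lambda>_. S) \<xi> {1..}"
    and init_indep: "indep_set {X\<^sub>0 -` A \<inter> space M | A. A \<in> sets borel}
          {(\<lambda>\<omega>. \<lambda>i\<in>{1..}. \<xi> i \<omega>) -` B \<inter> space M | B. B \<in> sets (PiM {1..} (\<lambda>_. S))}"
begin

text \<open>Index 0 carries the initial data in place of a sample, so that initial data and samples
  form one family indexed by the naturals.\<close>

definition events_at :: "nat \<Rightarrow> 'w set set" where
  "events_at i = (if i = 0 then {X\<^sub>0 -` A \<inter> space M | A. A \<in> sets borel}
                  else {\<xi> i -` A \<inter> space M | A. A \<in> sets S})"

text \<open>In a run this also determines the momenta, whose lengths are lost in the iterates; the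
  history of the iterates would be too coarse.\<close>

definition past :: "nat \<Rightarrow> 'w measure" where
  "past k = sigma (space M) (\<Union>i\<le>k. events_at i)"

lemma sample_measurable: "i \<ge> 1 \<Longrightarrow> \<xi> i \<in> M \<rightarrow>\<^sub>M S"
  using samples_indep unfolding indep_vars_def2 by auto

lemma events_at_subset: "events_at i \<subseteq> events"
  using indep_setD_ev1[OF init_indep] sample_measurable[of i]
  by (auto simp: events_at_def intro: measurable_sets)

lemma sets_past: "sets (past k) = sigma_sets (space M) (\<Union>i\<le>k. events_at i)"
  and space_past[simp]: "space (past k) = space M"
proof -
  have "(\<Union>i\<le>k. events_at i) \<subseteq> Pow (space M)"
    using events_at_subset sets.sets_into_space by blast
  then show "sets (past k) = sigma_sets (space M) (\<Union>i\<le>k. events_at i)"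
    and "space (past k) = space M"
    by (simp_all add: past_def)
qed

lemma subalgebra_past: "subalgebra M (past k)"
  using events_at_subset unfolding subalgebra_def sets_past by (auto intro!: sets.sigma_sets_subset)

lemma past_mono: "j \<le> k \<Longrightarrow> subalgebra (past k) (past j)"
  unfolding subalgebra_def sets_past space_past
  by (intro conjI refl sigma_sets_mono' UN_mono) auto

lemma events_at_past: "i \<le> k \<Longrightarrow> events_at i \<subseteq> sets (past k)"
  unfolding sets_past by auto

lemma init_past: "X\<^sub>0 \<in> borel_measurable (past k)"
  using events_at_past[of 0 k] by (intro measurableI) (auto simp: events_at_def)

lemma sample_past: "1 \<le> i \<Longrightarrow> i \<le> k \<Longrightarrow> \<xi> i \<in> past k \<rightarrow>\<^sub>M S"
  using events_at_past[of i k] measurable_space[OF sample_measurable, of i]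
  by (intro measurableI) (auto simp: events_at_def)

lemma Int_stable_events_at: "Int_stable (events_at i)"
  unfolding events_at_def by (auto intro: Int_stable_vimage)

text \<open>A finite intersection of sample events is a cylinder event of the whole sample sequence,
  so \<open>init_indep\<close> splits off the initial data, and the remaining events factor by
  independence of the samples.\<close>

lemma indep_events_at: "indep_sets events_at UNIV"
proof (rule indep_setsI)
  show "events_at i \<subseteq> events" for i by (rule events_at_subset)
next
  fix A :: "nat \<Rightarrow> 'w set" and J :: "nat set"
  assume J: "J \<noteq> {}" "finite J" and A: "\<forall>j\<in>J. A j \<in> events_at j"
  have samples: "prob (\<Inter>j\<in>K. A j) = (\<Prod>j\<in>K. prob (A j))" if "K \<subseteq> J - {0}" "K \<noteq> {}" for K
  proof (rule indep_setsD)
    show "indep_sets (\<lambda>i. {\<xi> i -` A \<inter> space M |A. A \<in> sets S}) {1..}"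
      using samples_indep unfolding indep_vars_def2 by auto
    show "\<forall>j\<in>K. A j \<in> {\<xi> j -` A \<inter> space M |A. A \<in> sets S}"
    proof
      fix j assume "j \<in> K"
      then have "j \<in> J" "j \<noteq> 0" using that by auto
      then show "A j \<in> {\<xi> j -` A \<inter> space M |A. A \<in> sets S}"
        using A by (auto simp: events_at_def)
    qed
    show "K \<subseteq> {1..}" using that by (auto simp: Suc_le_eq)
    show "finite K" using that J finite_subset by blast
  qed (use that in auto)
  show "prob (\<Inter>j\<in>J. A j) = (\<Prod>j\<in>J. prob (A j))"
  proof (cases "0 \<in> J \<and> J \<noteq> {0}")
    case False
    then show ?thesis
    proof (cases "0 \<in> J")
      case True
      with False have "J = {0}" by auto
      then show ?thesis by simp
    next
      case False
      then show ?thesis using J(1) by (intro samples) auto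
    qed
  next
    case True
    define K where "K = J - {0}"
    have K: "K \<noteq> {}" "finite K" "J = insert 0 K" "0 \<notin> K" using True J by (auto simp: K_def)
    have A0: "A 0 \<in> {X\<^sub>0 -` A \<inter> space M | A. A \<in> sets borel}"
      using bspec[OF A, of 0] True by (simp add: events_at_def)
    have "(\<Inter>j\<in>K. A j) \<in> {(\<lambda>\<omega>. \<lambda>i\<in>{1..}. \<xi> i \<omega>) -` B \<inter> space M | B. B \<in> sets (PiM {1..} (\<lambda>_. S))}"
    proof -
      have "\<forall>j\<in>K. \<exists>B. B \<in> sets S \<and> A j = \<xi> j -` B \<inter> space M"
      proof
        fix j assume "j \<in> K"
        then have "A j \<in> events_at j" "j \<noteq> 0" using A by (auto simp: K_def)
        then show "\<exists>B. B \<in> sets S \<and> A j = \<xi> j -` B \<inter> space M" by (auto simp: events_at_def)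
      qed
      then obtain B where B: "\<And>j. j \<in> K \<Longrightarrow> B j \<in> sets S \<and> A j = \<xi> j -` B j \<inter> space M"
        by metis
      let ?C = "{f \<in> space (PiM {1..} (\<lambda>_. S)). \<forall>j\<in>K. f j \<in> B j}"
      have Kge: "j \<ge> 1" if "j \<in> K" for j using that by (auto simp: K_def)
      have "?C \<in> sets (PiM {1..} (\<lambda>_. S))"
      proof (rule sets.sets_Collect_finite_All[OF _ K(2)])
        fix j assume j: "j \<in> K"
        have "(\<lambda>f. f j) -` B j \<inter> space (PiM {1..} (\<lambda>_. S)) \<in> sets (PiM {1..} (\<lambda>_. S))"
          using B[OF j] Kge[OF j] by (intro measurable_sets[OF measurable_component_singleton]) auto
        also have "(\<lambda>f. f j) -` B j \<inter> space (PiM {1..} (\<lambda>_. S))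
            = {f \<in> space (PiM {1..} (\<lambda>_. S)). f j \<in> B j}" by blast
        finally show "{f \<in> space (PiM {1..} (\<lambda>_. S)). f j \<in> B j} \<in> sets (PiM {1..} (\<lambda>_. S))" .
      qed
      moreover have "(\<lambda>\<omega>. \<lambda>i\<in>{1..}. \<xi> i \<omega>) -` ?C \<inter> space M = (\<Inter>j\<in>K. A j)"
      proof -
        have "(\<lambda>i\<in>{1..}. \<xi> i \<omega>) \<in> space (PiM {1..} (\<lambda>_. S))" if "\<omega> \<in> space M" for \<omega>
          using that by (auto simp: space_PiM intro: measurable_space[OF sample_measurable])
        then have "(\<lambda>\<omega>. \<lambda>i\<in>{1..}. \<xi> i \<omega>) -` ?C \<inter> space M = {\<omega> \<in> space M. \<forall>j\<in>K. \<xi> j \<omega> \<in> B j}"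
          using Kge by auto
        also have "\<dots> = (\<Inter>j\<in>K. \<xi> j -` B j \<inter> space M)" using K(1) by blast
        also have "\<dots> = (\<Inter>j\<in>K. A j)" using B by (intro INF_cong) simp_all
        finally show ?thesis .
      qed
      ultimately show ?thesis by blast
    qed
    then have "prob (A 0 \<inter> (\<Inter>j\<in>K. A j)) = prob (A 0) * prob (\<Inter>j\<in>K. A j)"
      using A0 by (intro indep_setD[OF init_indep])
    also have "prob (\<Inter>j\<in>K. A j) = (\<Prod>j\<in>K. prob (A j))"
      using K(1) by (intro samples) (simp_all add: K_def)
    finally show ?thesis using K by simp
  qed
qed

text \<open>Group the independent family into the indices up to \<open>k\<close> and the single
  index \<open>Suc k\<close>; each \<open>events_at i\<close> is closed under intersection, so
  independence passes to the generated sigma-algebras.\<close>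

lemma independent_of_past: "independent_of (past k) S (\<xi> (Suc k))"
proof -
  have "indep_sets (\<lambda>b. sigma_sets (space M) (\<Union>i\<in>case_bool {..k} {Suc k} b. events_at i)) UNIV"
  proof (rule indep_sets_collect_sigma)
    show "indep_sets events_at (\<Union>b. case_bool {..k} {Suc k} b)"
      using indep_events_at by (rule indep_sets_mono_index[rotated]) auto
    show "disjoint_family (case_bool {..k} {Suc k})"
      by (auto simp: disjoint_family_on_def split: bool.split)
  qed (rule Int_stable_events_at)
  then have "indep_set (sets (past k)) (events_at (Suc k))"
    unfolding indep_set_def sets_past
    by (rule indep_sets_mono_sets) (auto split: bool.split)
  then have "prob (A \<inter> (\<xi> (Suc k) -` B \<inter> space M)) = prob A * prob (\<xi> (Suc k) -` B \<inter> space M)"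
    if "A \<in> sets (past k)" "B \<in> sets S" for A B
    by (rule indep_setD) (use that in \<open>auto simp: events_at_def\<close>)
  then show ?thesis
    using subalgebra_past sample_measurable[of "Suc k"] by (simp add: independent_of_def)
qed

end

section \<open>Momentum error\<close>

text \<open>Jensen for the square, read off from a nonnegative variance.\<close>

lemma (in prob_space) expectation_norm_le_sqrt:
  fixes X :: "'a \<Rightarrow> 'b::euclidean_space"
  assumes [measurable]: "X \<in> borel_measurable M" and sq: "integrable M (\<lambda>\<omega>. (norm (X \<omega>))\<^sup>2)"
  shows "integrable M (\<lambda>\<omega>. norm (X \<omega>))"
    and "(\<integral>\<omega>. norm (X \<omega>) \<partial>M) \<le> sqrt (\<integral>\<omega>. (norm (X \<omega>))\<^sup>2 \<partial>M)"
proof -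
  have le: "t \<le> 1 + t\<^sup>2" if "t \<ge> 0" for t :: real
    using sum_squares_bound[of 1 t] that by simp
  have "integrable M (\<lambda>\<omega>. 1 + (norm (X \<omega>))\<^sup>2)" using sq by simp
  then show int: "integrable M (\<lambda>\<omega>. norm (X \<omega>))"
    by (rule Bochner_Integration.integrable_bound) (auto simp: le)
  have "0 \<le> variance (\<lambda>\<omega>. norm (X \<omega>))" by (rule variance_positive)
  also have "\<dots> = (\<integral>\<omega>. (norm (X \<omega>))\<^sup>2 \<partial>M) - (\<integral>\<omega>. norm (X \<omega>) \<partial>M)\<^sup>2"
    using int sq by (rule variance_eq)
  finally show "(\<integral>\<omega>. norm (X \<omega>) \<partial>M) \<le> sqrt (\<integral>\<omega>. (norm (X \<omega>))\<^sup>2 \<partial>M)"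
    by (intro real_le_rsqrt) simp
qed

lemma norm_sq_add_le: "(norm (a + b))\<^sup>2 \<le> 2 * (norm a)\<^sup>2 + 2 * (norm b)\<^sup>2"
  for a b :: "'a::real_normed_vector"
proof -
  have "(norm (a + b))\<^sup>2 \<le> (norm a + norm b)\<^sup>2"
    by (intro power_mono norm_triangle_ineq) simp
  also have "\<dots> \<le> 2 * (norm a)\<^sup>2 + 2 * (norm b)\<^sup>2"
    using sum_squares_bound[of "norm a" "norm b"] by (simp add: power2_sum)
  finally show ?thesis .
qed

text \<open>\<open>c / \<beta>\<close> is the fixed point of the recursion with equality; the
  distance to it shrinks by \<open>1 - \<beta>\<close> each time.\<close>

lemma contraction_bound:
  fixes a :: "nat \<Rightarrow> real"
  assumes "\<And>k. a (Suc k) \<le> (1 - \<beta>) * a k + c" and \<beta>: "0 < \<beta>" "\<beta> \<le> 1" and "c \<ge> 0"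
  shows "a k \<le> (1 - \<beta>) ^ k * a 0 + c / \<beta>"
proof (induction k)
  case 0
  show ?case using assms by simp
next
  case (Suc k)
  have "a (Suc k) \<le> (1 - \<beta>) * ((1 - \<beta>) ^ k * a 0 + c / \<beta>) + c"
    using assms(1)[of k] mult_left_mono[OF Suc.IH, of "1 - \<beta>"] \<beta> by simp
  also have "\<dots> = (1 - \<beta>) ^ Suc k * a 0 + c / \<beta>"
    using \<beta> by (simp add: field_simps)
  finally show ?case .
qed

text \<open>Equal smoothing factors let both momentum blocks be treated as a single vector, so this
  analysis ignores the saddle structure: the update enters through a measurable function of the
  momentum that is bounded by \<open>D\<close>.\<close>

locale momentum_run = sample_stream M S \<xi> X\<^sub>0
  for M :: "'w measure" and S :: "'s measure" and \<xi> and X\<^sub>0 :: "'w \<Rightarrow> 'c::topological_space" +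
  fixes Q :: "'z::euclidean_space \<Rightarrow> 's \<Rightarrow> real" and J :: "'z \<Rightarrow> real"
    and z m :: "nat \<Rightarrow> 'w \<Rightarrow> 'z" and dir :: "'z \<Rightarrow> 'z"
    and \<beta> D \<sigma> \<sigma>h L\<^sub>h :: real
  assumes Q_grad_meas: "(\<lambda>(z, s). grad (\<lambda>z. Q z s) z) \<in> borel_measurable (borel \<Otimes>\<^sub>M S)"
    and Q_hess_meas: "\<And>u. (\<lambda>(z, s). blinfun_apply (hess (\<lambda>z. Q z s) z) u)
                        \<in> borel_measurable (borel \<Otimes>\<^sub>M S)"
    and J_diff: "twice_differentiable J"
    and hess_lip: "L\<^sub>h-lipschitz_on UNIV (hess J)"
    and z0: "z 0 \<in> borel_measurable (past 0)" and m0: "m 0 \<in> borel_measurable (past 0)"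
    and dir[measurable]: "dir \<in> borel_measurable borel" and dir_le: "\<And>v. norm (dir v) \<le> D"
    and z_Suc: "\<And>i \<omega>. z (Suc i) \<omega> = z i \<omega> + dir (m i \<omega>)"
    and m_Suc: "\<And>i \<omega>. m (Suc i) \<omega>
          = (1 - \<beta>) *\<^sub>R (m i \<omega> + hess (\<lambda>z. Q z (\<xi> (Suc i) \<omega>)) (z (Suc i) \<omega>) (dir (m i \<omega>)))
            + \<beta> *\<^sub>R grad (\<lambda>z. Q z (\<xi> (Suc i) \<omega>)) (z (Suc i) \<omega>)"
    and \<beta>: "0 < \<beta>" "\<beta> \<le> 1"
    and noise: "\<And>i. i \<ge> 1 \<Longrightarrow> unbiased_bounded_noise M Q J \<sigma> \<sigma>h z \<xi> i"
    and init_int: "integrable M (\<lambda>\<omega>. norm (m 0 \<omega> - grad J (z 0 \<omega>)))"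
begin

section \<open>Sampling noise and its orthogonality to the past\<close>

definition grad_noise :: "'z \<Rightarrow> 's \<Rightarrow> 'z" where
  "grad_noise w s = grad (\<lambda>z. Q z s) w - grad J w"

definition hess_noise :: "'z \<Rightarrow> 's \<Rightarrow> 'z \<Rightarrow>\<^sub>L 'z" where
  "hess_noise w s = hess (\<lambda>z. Q z s) w - hess J w"

lemma grad_J_borel[measurable]: "grad J \<in> borel_measurable borel"
proof (rule borel_measurable_continuous_onI)
  show "continuous_on UNIV (grad J)"
    using twice_differentiable_hess[OF J_diff]
    by (rule has_derivative_continuous_on[OF has_derivative_at_withinI])
qed

lemma hess_J_borel[measurable]: "(\<lambda>w. blinfun_apply (hess J w) u) \<in> borel_measurable borel"
  using lipschitz_on_continuous_on[OF hess_lip]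
  by (intro borel_measurable_continuous_onI continuous_intros)

lemma grad_noise_borel: "case_prod grad_noise \<in> borel_measurable (borel \<Otimes>\<^sub>M S)"
proof -
  have "(\<lambda>p. (case p of (z, s) \<Rightarrow> grad (\<lambda>z. Q z s) z) - grad J (fst p)) \<in> borel_measurable (borel \<Otimes>\<^sub>M S)"
    using Q_grad_meas by measurable
  then show ?thesis by (simp add: grad_noise_def case_prod_beta')
qed

lemma hess_noise_borel: "(\<lambda>(w, s). blinfun_apply (hess_noise w s) u) \<in> borel_measurable (borel \<Otimes>\<^sub>M S)"
proof -
  have "(\<lambda>p. (case p of (z, s) \<Rightarrow> blinfun_apply (hess (\<lambda>z. Q z s) z) u) - blinfun_apply (hess J (fst p)) u)
      \<in> borel_measurable (borel \<Otimes>\<^sub>M S)"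
    using Q_hess_meas[of u] by measurable
  then show ?thesis by (simp add: hess_noise_def case_prod_beta' blinfun.diff_left)
qed

lemma iterates_past:
  "z k \<in> borel_measurable (past k)" "m k \<in> borel_measurable (past k)"
proof (induction k)
  case 0
  show "z 0 \<in> borel_measurable (past 0)" "m 0 \<in> borel_measurable (past 0)" using z0 m0 .
next
  case (Suc k)
  have [measurable]: "z k \<in> borel_measurable (past (Suc k))" "m k \<in> borel_measurable (past (Suc k))"
    using measurable_from_subalg[OF past_mono, of k "Suc k"] Suc by auto
  have [measurable]: "\<xi> (Suc k) \<in> past (Suc k) \<rightarrow>\<^sub>M S" by (rule sample_past) auto
  have z: "(\<lambda>\<omega>. z k \<omega> + dir (m k \<omega>)) \<in> borel_measurable (past (Suc k))" by measurable
  then show zS[measurable]: "z (Suc k) \<in> borel_measurable (past (Suc k))"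
    by (simp add: z_Suc[abs_def])
  have pair: "(\<lambda>\<omega>. (z (Suc k) \<omega>, \<xi> (Suc k) \<omega>)) \<in> past (Suc k) \<rightarrow>\<^sub>M borel \<Otimes>\<^sub>M S" by measurable
  have [measurable]: "(\<lambda>\<omega>. grad (\<lambda>z. Q z (\<xi> (Suc k) \<omega>)) (z (Suc k) \<omega>)) \<in> borel_measurable (past (Suc k))"
    using measurable_compose[OF pair Q_grad_meas] by simp
  have [measurable]: "(\<lambda>\<omega>. hess (\<lambda>z. Q z (\<xi> (Suc k) \<omega>)) (z (Suc k) \<omega>) (dir (m k \<omega>)))
      \<in> borel_measurable (past (Suc k))"
  proof (rule borel_measurable_blinfun_apply)
    show "(\<lambda>\<omega>. hess (\<lambda>z. Q z (\<xi> (Suc k) \<omega>)) (z (Suc k) \<omega>) u) \<in> borel_measurable (past (Suc k))" for u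
      using measurable_compose[OF pair Q_hess_meas[of u]] by simp
  qed measurable
  show "m (Suc k) \<in> borel_measurable (past (Suc k))"
    unfolding m_Suc[abs_def] by measurable
qed

text \<open>The iterate with index \<open>Suc k\<close> is fixed before the sample
  \<open>\<xi> (Suc k)\<close> is drawn. This shift is what makes the new noise orthogonal to
  everything up to \<open>k\<close>.\<close>

lemma next_iterate_past: "z (Suc k) \<in> borel_measurable (past k)"
proof -
  note [measurable] = iterates_past[of k]
  have "(\<lambda>\<omega>. z k \<omega> + dir (m k \<omega>)) \<in> borel_measurable (past k)" by measurable
  then show ?thesis by (simp add: z_Suc[abs_def])
qed

lemma past_borel: "f \<in> borel_measurable (past k) \<Longrightarrow> f \<in> borel_measurable M"
  using measurable_from_subalg[OF subalgebra_past] .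

lemma z_borel[measurable]: "z k \<in> borel_measurable M" and m_borel[measurable]: "m k \<in> borel_measurable M"
  using iterates_past past_borel by auto

abbreviation grad_noise_at :: "nat \<Rightarrow> 'w \<Rightarrow> 'z" where
  "grad_noise_at k \<omega> \<equiv> grad_noise (z k \<omega>) (\<xi> k \<omega>)"

abbreviation hess_noise_at :: "nat \<Rightarrow> 'w \<Rightarrow> 'z \<Rightarrow>\<^sub>L 'z" where
  "hess_noise_at k \<omega> \<equiv> hess_noise (z k \<omega>) (\<xi> k \<omega>)"

lemma sample_pair: "k \<ge> 1 \<Longrightarrow> (\<lambda>\<omega>. (z k \<omega>, \<xi> k \<omega>)) \<in> M \<rightarrow>\<^sub>M borel \<Otimes>\<^sub>M S"
  using sample_measurable by measurable

lemma grad_noise_at_borel: "k \<ge> 1 \<Longrightarrow> grad_noise_at k \<in> borel_measurable M"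
  using measurable_compose[OF sample_pair grad_noise_borel] by simp

lemma hess_noise_at_borel:
  "k \<ge> 1 \<Longrightarrow> (\<lambda>\<omega>. blinfun_apply (hess_noise_at k \<omega>) u) \<in> borel_measurable M"
  using measurable_compose[OF sample_pair hess_noise_borel] by simp

lemma subalgebra_history_z: "subalgebra M (history M z k)"
  by (rule subalgebra_history) simp

lemma grad_noise_second_moment:
  assumes "k \<ge> 1"
  shows "integrable M (\<lambda>\<omega>. (norm (grad_noise_at k \<omega>))\<^sup>2)"
    "(\<integral>\<omega>. (norm (grad_noise_at k \<omega>))\<^sup>2 \<partial>M) \<le> \<sigma>\<^sup>2"
proof -
  have "AE \<omega> in M. nn_cond_exp M (history M z k) (\<lambda>\<omega>. ennreal ((norm (grad_noise_at k \<omega>))\<^sup>2)) \<omega>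
      \<le> ennreal (\<sigma>\<^sup>2)"
    using noise[OF assms] by (simp add: unbiased_bounded_noise_def Let_def grad_noise_def)
  then show "integrable M (\<lambda>\<omega>. (norm (grad_noise_at k \<omega>))\<^sup>2)"
    "(\<integral>\<omega>. (norm (grad_noise_at k \<omega>))\<^sup>2 \<partial>M) \<le> \<sigma>\<^sup>2"
    using cond_second_moment_le[OF subalgebra_history_z[of k],
        of "\<lambda>\<omega>. (norm (grad_noise_at k \<omega>))\<^sup>2" "\<sigma>\<^sup>2"] grad_noise_at_borel[OF assms]
    by auto
qed

lemma hess_noise_second_moment:
  assumes "k \<ge> 1"
  shows "integrable M (\<lambda>\<omega>. (norm (hess_noise_at k \<omega>))\<^sup>2)"
    "(\<integral>\<omega>. (norm (hess_noise_at k \<omega>))\<^sup>2 \<partial>M) \<le> \<sigma>h\<^sup>2"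
proof -
  have [measurable]: "(\<lambda>\<omega>. norm (hess_noise_at k \<omega>)) \<in> borel_measurable M"
    by (rule borel_measurable_norm_blinfun) (rule hess_noise_at_borel[OF assms])
  have "AE \<omega> in M. nn_cond_exp M (history M z k) (\<lambda>\<omega>. ennreal ((norm (hess_noise_at k \<omega>))\<^sup>2)) \<omega>
      \<le> ennreal (\<sigma>h\<^sup>2)"
    using noise[OF assms] by (simp add: unbiased_bounded_noise_def Let_def hess_noise_def)
  then show "integrable M (\<lambda>\<omega>. (norm (hess_noise_at k \<omega>))\<^sup>2)"
    "(\<integral>\<omega>. (norm (hess_noise_at k \<omega>))\<^sup>2 \<partial>M) \<le> \<sigma>h\<^sup>2"
    using cond_second_moment_le[OF subalgebra_history_z[of k],
        of "\<lambda>\<omega>. (norm (hess_noise_at k \<omega>))\<^sup>2" "\<sigma>h\<^sup>2"]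
    by auto
qed

lemma grad_noise_orthogonal:
  assumes W: "W \<in> borel_measurable (past k)" and sq: "integrable M (\<lambda>\<omega>. (norm (W \<omega>))\<^sup>2)"
  shows "integrable M (\<lambda>\<omega>. W \<omega> \<bullet> grad_noise_at (Suc k) \<omega>)"
    "(\<integral>\<omega>. W \<omega> \<bullet> grad_noise_at (Suc k) \<omega> \<partial>M) = 0"
proof -
  have "has_cond_exp M (history M z (Suc k)) (\<lambda>\<omega>. grad (\<lambda>z. Q z (\<xi> (Suc k) \<omega>)) (z (Suc k) \<omega>))
      (\<lambda>\<omega>. grad J (z (Suc k) \<omega>))"
    using noise[of "Suc k"] by (simp add: unbiased_bounded_noise_def Let_def)
  then have int: "integrable M (\<lambda>\<omega>. grad_noise_at (Suc k) \<omega> \<bullet> b)"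
    and zero: "\<lbrakk>s \<in> borel_measurable borel; \<And>z. \<bar>s z\<bar> \<le> 1\<rbrakk>
      \<Longrightarrow> (\<integral>\<omega>. s (z (Suc k) \<omega>) * (grad_noise_at (Suc k) \<omega> \<bullet> b) \<partial>M) = 0"
    if "b \<in> Basis" for b s
    unfolding grad_noise_def
    using has_cond_exp_centred[OF subalgebra_history_z _ _ that]
      measurable_compose[OF borel_measurable_history[of z "Suc k" M], of s borel]
    by auto
  have sq_noise: "integrable M (\<lambda>\<omega>. (norm (grad_noise_at (Suc k) \<omega>))\<^sup>2)"
    by (rule grad_noise_second_moment) simp
  note orth = centred_noise_inner_orthogonal[where q = grad_noise, OF independent_of_past
      next_iterate_past W grad_noise_borel _ sq_noise sq]
  show "integrable M (\<lambda>\<omega>. W \<omega> \<bullet> grad_noise_at (Suc k) \<omega>)"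
    by (rule orth(1)) (use int zero in auto)
  show "(\<integral>\<omega>. W \<omega> \<bullet> grad_noise_at (Suc k) \<omega> \<partial>M) = 0"
    by (rule orth(2)) (use int zero in auto)
qed

lemma hess_noise_orthogonal:
  assumes W: "W \<in> borel_measurable (past k)" and sq: "integrable M (\<lambda>\<omega>. (norm (W \<omega>))\<^sup>2)"
  shows "integrable M (\<lambda>\<omega>. W \<omega> \<bullet> blinfun_apply (hess_noise_at (Suc k) \<omega>) u)"
    "(\<integral>\<omega>. W \<omega> \<bullet> blinfun_apply (hess_noise_at (Suc k) \<omega>) u \<partial>M) = 0"
proof -
  have "has_cond_exp M (history M z (Suc k)) (\<lambda>\<omega>. blinfun_apply (hess (\<lambda>z. Q z (\<xi> (Suc k) \<omega>)) (z (Suc k) \<omega>)) u)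
      (\<lambda>\<omega>. blinfun_apply (hess J (z (Suc k) \<omega>)) u)"
    using noise[of "Suc k"] by (simp add: unbiased_bounded_noise_def Let_def)
  then have int: "integrable M (\<lambda>\<omega>. blinfun_apply (hess_noise_at (Suc k) \<omega>) u \<bullet> b)"
    and zero: "\<lbrakk>s \<in> borel_measurable borel; \<And>z. \<bar>s z\<bar> \<le> 1\<rbrakk>
      \<Longrightarrow> (\<integral>\<omega>. s (z (Suc k) \<omega>) * (blinfun_apply (hess_noise_at (Suc k) \<omega>) u \<bullet> b) \<partial>M) = 0"
    if "b \<in> Basis" for b s
    unfolding hess_noise_def blinfun.diff_left
    using has_cond_exp_centred[OF subalgebra_history_z _ _ that]
      measurable_compose[OF borel_measurable_history[of z "Suc k" M], of s borel]
    by auto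
  have "integrable M (\<lambda>\<omega>. (norm u)\<^sup>2 * (norm (hess_noise_at (Suc k) \<omega>))\<^sup>2)"
    using hess_noise_second_moment(1)[of "Suc k"] by simp
  then have sq_u: "integrable M (\<lambda>\<omega>. (norm (blinfun_apply (hess_noise_at (Suc k) \<omega>) u))\<^sup>2)"
  proof (rule Bochner_Integration.integrable_bound)
    have [measurable]: "(\<lambda>\<omega>. blinfun_apply (hess_noise_at (Suc k) \<omega>) u) \<in> borel_measurable M"
      by (rule hess_noise_at_borel) simp
    show "(\<lambda>\<omega>. (norm (blinfun_apply (hess_noise_at (Suc k) \<omega>) u))\<^sup>2) \<in> borel_measurable M"
      by measurable
    have "(norm (blinfun_apply A u))\<^sup>2 \<le> (norm u)\<^sup>2 * (norm A)\<^sup>2" for A :: "'z \<Rightarrow>\<^sub>L 'z"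
      using power_mono[OF norm_blinfun[of A u], of 2] by (simp add: power_mult_distrib mult.commute)
    then show "AE \<omega> in M. norm ((norm (blinfun_apply (hess_noise_at (Suc k) \<omega>) u))\<^sup>2)
        \<le> norm ((norm u)\<^sup>2 * (norm (hess_noise_at (Suc k) \<omega>))\<^sup>2)"
      by (simp add: abs_mult)
  qed
  note orth = centred_noise_inner_orthogonal[where q = "\<lambda>w s. blinfun_apply (hess_noise w s) u",
      OF independent_of_past next_iterate_past W hess_noise_borel _ sq_u sq]
  show "integrable M (\<lambda>\<omega>. W \<omega> \<bullet> blinfun_apply (hess_noise_at (Suc k) \<omega>) u)"
    by (rule orth(1)) (use int zero in auto)
  show "(\<integral>\<omega>. W \<omega> \<bullet> blinfun_apply (hess_noise_at (Suc k) \<omega>) u \<partial>M) = 0"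
    by (rule orth(2)) (use int zero in auto)
qed

lemma norm_sq_bounded_scale_integrable:
  fixes r :: "'w \<Rightarrow> real" and W :: "'w \<Rightarrow> 'z"
  assumes [measurable]: "r \<in> borel_measurable M" "W \<in> borel_measurable M"
    and sq: "integrable M (\<lambda>\<omega>. (norm (W \<omega>))\<^sup>2)" and r: "\<And>\<omega>. \<bar>r \<omega>\<bar> \<le> c"
  shows "integrable M (\<lambda>\<omega>. (norm (r \<omega> *\<^sub>R W \<omega>))\<^sup>2)"
proof (rule Bochner_Integration.integrable_bound)
  show "integrable M (\<lambda>\<omega>. c\<^sup>2 * (norm (W \<omega>))\<^sup>2)" using sq by simp
  have "(norm (r \<omega> *\<^sub>R W \<omega>))\<^sup>2 \<le> c\<^sup>2 * (norm (W \<omega>))\<^sup>2" for \<omega>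
    using r[of \<omega>] unfolding norm_scaleR power_mult_distrib
    by (intro mult_right_mono power_mono) auto
  then show "AE \<omega> in M. norm ((norm (r \<omega> *\<^sub>R W \<omega>))\<^sup>2) \<le> norm (c\<^sup>2 * (norm (W \<omega>))\<^sup>2)"
    by (simp add: abs_mult)
qed measurable

text \<open>The direction is determined by the past, so its coordinates can be moved onto
  \<open>W\<close>; bounded by \<open>D\<close>, they keep \<open>W\<close> square integrable, and
  the Hessian noise is left with fixed basis vectors as arguments.\<close>

lemma hess_noise_dir_orthogonal:
  assumes W: "W \<in> borel_measurable (past k)" and sq: "integrable M (\<lambda>\<omega>. (norm (W \<omega>))\<^sup>2)"
  shows "integrable M (\<lambda>\<omega>. W \<omega> \<bullet> blinfun_apply (hess_noise_at (Suc k) \<omega>) (dir (m k \<omega>)))"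
    "(\<integral>\<omega>. W \<omega> \<bullet> blinfun_apply (hess_noise_at (Suc k) \<omega>) (dir (m k \<omega>)) \<partial>M) = 0"
proof -
  let ?W = "\<lambda>b \<omega>. (dir (m k \<omega>) \<bullet> b) *\<^sub>R W \<omega>"
  have W_b: "?W b \<in> borel_measurable (past k)" for b
    using W iterates_past(2)[of k] by measurable
  have [measurable]: "W \<in> borel_measurable M" using W by (rule past_borel)
  have sq_b: "integrable M (\<lambda>\<omega>. (norm (?W b \<omega>))\<^sup>2)" if "b \<in> Basis" for b
  proof (rule norm_sq_bounded_scale_integrable[OF _ _ sq])
    show "\<bar>dir (m k \<omega>) \<bullet> b\<bar> \<le> D" for \<omega>
      using Basis_le_norm[OF that] dir_le order_trans by blast
  qed measurable
  have eq: "W \<omega> \<bullet> blinfun_apply (hess_noise_at (Suc k) \<omega>) (dir (m k \<omega>))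
      = (\<Sum>b\<in>Basis. ?W b \<omega> \<bullet> blinfun_apply (hess_noise_at (Suc k) \<omega>) b)" for \<omega>
    by (subst blinfun_apply_basis_sum) (simp add: inner_sum_right)
  show "integrable M (\<lambda>\<omega>. W \<omega> \<bullet> blinfun_apply (hess_noise_at (Suc k) \<omega>) (dir (m k \<omega>)))"
    unfolding eq by (intro Bochner_Integration.integrable_sum hess_noise_orthogonal(1) W_b sq_b)
  show "(\<integral>\<omega>. W \<omega> \<bullet> blinfun_apply (hess_noise_at (Suc k) \<omega>) (dir (m k \<omega>)) \<partial>M) = 0"
    unfolding eq
    by (subst Bochner_Integration.integral_sum)
      (simp_all only: hess_noise_orthogonal[OF W_b sq_b] sum.neutral_const cong: sum.cong)
qed

section \<open>Splitting the momentum error into noise and bias\<close>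

definition increment :: "nat \<Rightarrow> 'w \<Rightarrow> 'z" where
  "increment k \<omega> = (1 - \<beta>) *\<^sub>R blinfun_apply (hess_noise_at (Suc k) \<omega>) (dir (m k \<omega>))
                    + \<beta> *\<^sub>R grad_noise_at (Suc k) \<omega>"

text \<open>The increments, weighted geometrically with ratio \<open>1 - \<beta>\<close>. The start
  at 0 puts the initial error entirely into the bias, so that second moments concern sampling noise
  alone.\<close>

primrec noise_sum :: "nat \<Rightarrow> 'w \<Rightarrow> 'z" where
  "noise_sum 0 \<omega> = 0"
| "noise_sum (Suc k) \<omega> = (1 - \<beta>) *\<^sub>R noise_sum k \<omega> + increment k \<omega>"

text \<open>Bound for the second moment of one increment. Gradient and Hessian noise come from the
  same sample and may be correlated, which costs the factor 2.\<close>

definition noise_level :: real where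
  "noise_level = 2 * ((\<sigma>h * D)\<^sup>2 + (\<beta> * \<sigma>)\<^sup>2)"

lemma noise_level_nonneg: "noise_level \<ge> 0"
  by (simp add: noise_level_def)

lemma increment_past: "increment k \<in> borel_measurable (past (Suc k))"
proof -
  note [measurable] = iterates_past[of "Suc k"]
  have [measurable]: "m k \<in> borel_measurable (past (Suc k))"
    using measurable_from_subalg[OF past_mono, of k "Suc k"] iterates_past(2)[of k] by auto
  have [measurable]: "\<xi> (Suc k) \<in> past (Suc k) \<rightarrow>\<^sub>M S" by (rule sample_past) auto
  have pair: "(\<lambda>\<omega>. (z (Suc k) \<omega>, \<xi> (Suc k) \<omega>)) \<in> past (Suc k) \<rightarrow>\<^sub>M borel \<Otimes>\<^sub>M S" by measurable
  have [measurable]: "grad_noise_at (Suc k) \<in> borel_measurable (past (Suc k))"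
    using measurable_compose[OF pair grad_noise_borel] by simp
  have [measurable]: "(\<lambda>\<omega>. blinfun_apply (hess_noise_at (Suc k) \<omega>) (dir (m k \<omega>)))
      \<in> borel_measurable (past (Suc k))"
  proof (rule borel_measurable_blinfun_apply)
    show "(\<lambda>\<omega>. blinfun_apply (hess_noise_at (Suc k) \<omega>) u) \<in> borel_measurable (past (Suc k))" for u
      using measurable_compose[OF pair hess_noise_borel[of u]] by simp
  qed measurable
  show ?thesis unfolding increment_def[abs_def] by measurable
qed

lemma noise_sum_past: "noise_sum k \<in> borel_measurable (past k)"
proof (induction k)
  case 0
  show ?case by (simp add: noise_sum.simps(1)[abs_def])
next
  case (Suc k)
  have [measurable]: "noise_sum k \<in> borel_measurable (past (Suc k))"
    using measurable_from_subalg[OF past_mono, of k "Suc k"] Suc by auto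
  note [measurable] = increment_past[of k]
  have "(\<lambda>\<omega>. (1 - \<beta>) *\<^sub>R noise_sum k \<omega> + increment k \<omega>) \<in> borel_measurable (past (Suc k))"
    by measurable
  then show ?case by (simp add: fun_eq_iff[symmetric] cong: measurable_cong)
qed

lemma increment_second_moment:
  "integrable M (\<lambda>\<omega>. (norm (increment k \<omega>))\<^sup>2)"
  "(\<integral>\<omega>. (norm (increment k \<omega>))\<^sup>2 \<partial>M) \<le> noise_level"
proof -
  let ?B = "\<lambda>\<omega>. 2 * (D\<^sup>2 * (norm (hess_noise_at (Suc k) \<omega>))\<^sup>2) + 2 * (\<beta>\<^sup>2 * (norm (grad_noise_at (Suc k) \<omega>))\<^sup>2)"
  have le: "(norm (increment k \<omega>))\<^sup>2 \<le> ?B \<omega>" for \<omega>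
  proof -
    have "norm ((1 - \<beta>) *\<^sub>R blinfun_apply (hess_noise_at (Suc k) \<omega>) (dir (m k \<omega>)))
        \<le> norm (blinfun_apply (hess_noise_at (Suc k) \<omega>) (dir (m k \<omega>)))"
      using \<beta> by (simp add: mult_left_le_one_le)
    also have "\<dots> \<le> norm (hess_noise_at (Suc k) \<omega>) * D"
      by (intro order_trans[OF norm_blinfun] mult_left_mono dir_le) simp
    finally have "(norm ((1 - \<beta>) *\<^sub>R blinfun_apply (hess_noise_at (Suc k) \<omega>) (dir (m k \<omega>))))\<^sup>2
        \<le> D\<^sup>2 * (norm (hess_noise_at (Suc k) \<omega>))\<^sup>2"
      using power_mono[of _ _ 2] by (fastforce simp: power_mult_distrib mult.commute)
    moreover have "(norm (\<beta> *\<^sub>R grad_noise_at (Suc k) \<omega>))\<^sup>2 = \<beta>\<^sup>2 * (norm (grad_noise_at (Suc k) \<omega>))\<^sup>2"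
      by (simp add: power_mult_distrib)
    ultimately show ?thesis
      unfolding increment_def by (intro order_trans[OF norm_sq_add_le]) simp
  qed
  have B: "integrable M ?B"
    using hess_noise_second_moment(1)[of "Suc k"] grad_noise_second_moment(1)[of "Suc k"] by simp
  have [measurable]: "increment k \<in> borel_measurable M" using increment_past by (rule past_borel)
  show int: "integrable M (\<lambda>\<omega>. (norm (increment k \<omega>))\<^sup>2)"
    using B by (rule Bochner_Integration.integrable_bound) (use le in \<open>auto intro: order_trans[OF _ abs_ge_self]\<close>)
  have "(\<integral>\<omega>. (norm (increment k \<omega>))\<^sup>2 \<partial>M) \<le> (\<integral>\<omega>. ?B \<omega> \<partial>M)"
    using int B le by (rule integral_mono)
  also have "\<dots> = 2 * (D\<^sup>2 * (\<integral>\<omega>. (norm (hess_noise_at (Suc k) \<omega>))\<^sup>2 \<partial>M))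
      + 2 * (\<beta>\<^sup>2 * (\<integral>\<omega>. (norm (grad_noise_at (Suc k) \<omega>))\<^sup>2 \<partial>M))"
    using hess_noise_second_moment(1)[of "Suc k"] grad_noise_second_moment(1)[of "Suc k"] by simp
  also have "\<dots> \<le> 2 * (D\<^sup>2 * \<sigma>h\<^sup>2) + 2 * (\<beta>\<^sup>2 * \<sigma>\<^sup>2)"
    using hess_noise_second_moment(2)[of "Suc k"] grad_noise_second_moment(2)[of "Suc k"]
    by (intro add_mono mult_left_mono) auto
  finally show "(\<integral>\<omega>. (norm (increment k \<omega>))\<^sup>2 \<partial>M) \<le> noise_level"
    by (simp add: noise_level_def power_mult_distrib mult.commute)
qed

lemma noise_sum_increment_orthogonal:
  assumes "integrable M (\<lambda>\<omega>. (norm (noise_sum k \<omega>))\<^sup>2)"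
  shows "integrable M (\<lambda>\<omega>. noise_sum k \<omega> \<bullet> increment k \<omega>)"
    "(\<integral>\<omega>. noise_sum k \<omega> \<bullet> increment k \<omega> \<partial>M) = 0"
  using hess_noise_dir_orthogonal[OF noise_sum_past assms] grad_noise_orthogonal[OF noise_sum_past assms]
  by (simp_all add: increment_def inner_add_right)

text \<open>Orthogonality removes the cross term, so the second moment contracts by
  \<open>(1 - \<beta>)\<^sup>2\<close>, which is at most \<open>1 - \<beta>\<close>;
  \<open>noise_level / \<beta>\<close> is the fixed point of the weaker recursion.\<close>

lemma noise_sum_second_moment:
  "integrable M (\<lambda>\<omega>. (norm (noise_sum k \<omega>))\<^sup>2) \<and>
   (\<integral>\<omega>. (norm (noise_sum k \<omega>))\<^sup>2 \<partial>M) \<le> noise_level / \<beta>"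
proof (induction k)
  case 0
  show ?case using \<beta> noise_level_nonneg by simp
next
  case (Suc k)
  define v where "v = (\<integral>\<omega>. (norm (noise_sum k \<omega>))\<^sup>2 \<partial>M)"
  have int: "integrable M (\<lambda>\<omega>. (norm (noise_sum k \<omega>))\<^sup>2)" and v: "v \<le> noise_level / \<beta>"
    using Suc by (auto simp: v_def)
  note orth = noise_sum_increment_orthogonal[OF int]
  have eq: "(norm (noise_sum (Suc k) \<omega>))\<^sup>2 = (1 - \<beta>)\<^sup>2 * (norm (noise_sum k \<omega>))\<^sup>2
      + 2 * (1 - \<beta>) * (noise_sum k \<omega> \<bullet> increment k \<omega>) + (norm (increment k \<omega>))\<^sup>2" for \<omega>
    by (simp add: dot_square_norm[symmetric] inner_add_left inner_add_right inner_commute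
        power2_eq_square[of "1 - \<beta>"])
  have "(\<integral>\<omega>. (norm (noise_sum (Suc k) \<omega>))\<^sup>2 \<partial>M)
      = (1 - \<beta>)\<^sup>2 * v + (\<integral>\<omega>. (norm (increment k \<omega>))\<^sup>2 \<partial>M)"
    unfolding eq v_def using int orth increment_second_moment(1)[of k] by simp
  also have "\<dots> \<le> (1 - \<beta>) * (noise_level / \<beta>) + noise_level"
  proof (intro add_mono increment_second_moment(2))
    have "v \<ge> 0" by (simp add: v_def)
    have "(1 - \<beta>)\<^sup>2 * v = (1 - \<beta>) * ((1 - \<beta>) * v)" by (simp add: power2_eq_square)
    also have "\<dots> \<le> (1 - \<beta>) * v"
      using \<beta> \<open>v \<ge> 0\<close> by (intro mult_left_mono mult_left_le_one_le) auto
    also have "\<dots> \<le> (1 - \<beta>) * (noise_level / \<beta>)"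
      using \<beta> v by (intro mult_left_mono) auto
    finally show "(1 - \<beta>)\<^sup>2 * v \<le> (1 - \<beta>) * (noise_level / \<beta>)" .
  qed
  also have "\<dots> = noise_level / \<beta>" using \<beta> by (simp add: field_simps)
  finally show ?case
    unfolding eq using int orth(1) increment_second_moment(1)[of k] by simp
qed

text \<open>Once the noise is subtracted, the error obeys a recursion valid for each
  \<open>\<omega>\<close>: it receives one Taylor remainder of \<open>grad J\<close> and is then
  multiplied by \<open>1 - \<beta>\<close>.\<close>

lemma bias_le:
  "norm (m k \<omega> - grad J (z k \<omega>) - noise_sum k \<omega>)
     \<le> (1 - \<beta>) ^ k * norm (m 0 \<omega> - grad J (z 0 \<omega>)) + L\<^sub>h * D\<^sup>2 / \<beta>"
proof -
  define d where "d k = m k \<omega> - grad J (z k \<omega>) - noise_sum k \<omega>" for k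
  have Lh: "L\<^sub>h \<ge> 0" using hess_lip by (rule lipschitz_on_nonneg)
  have "norm (d (Suc k)) \<le> (1 - \<beta>) * norm (d k) + L\<^sub>h * D\<^sup>2" for k
  proof -
    define u where "u = dir (m k \<omega>)"
    define w where "w = z k \<omega>"
    define w' where "w' = z (Suc k) \<omega>"
    \<comment> \<open>Expansion about the new point \<open>w'\<close>, because the algorithm
      evaluates the Hessian there. As \<open>w - w' = - u\<close>, the mean of the Hessian
      correction is exactly the linear part of this remainder.\<close>
    define r where "r = grad J w - grad J w' - blinfun_apply (hess J w') (w - w')"
    have u: "w - w' = - u" by (simp add: w_def w'_def u_def z_Suc)
    have "norm r \<le> L\<^sub>h * (norm (w - w'))\<^sup>2"
      unfolding r_def
    proof (rule taylor_lipschitz_derivative[OF twice_differentiable_hess[OF J_diff] _ Lh])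
      fix x h
      have "norm (blinfun_apply (hess J x) h - blinfun_apply (hess J w') h)
          \<le> norm (hess J x - hess J w') * norm h"
        unfolding blinfun.diff_left[symmetric] by (rule norm_blinfun)
      also have "\<dots> \<le> L\<^sub>h * norm (x - w') * norm h"
        using lipschitz_onD[OF hess_lip, of x w'] by (intro mult_right_mono) (auto simp: dist_norm)
      finally show "norm (blinfun_apply (hess J x) h - blinfun_apply (hess J w') h)
          \<le> L\<^sub>h * norm (x - w') * norm h" .
    qed
    also have "\<dots> \<le> L\<^sub>h * D\<^sup>2"
      unfolding u norm_minus_cancel u_def using Lh by (intro mult_left_mono power_mono dir_le) auto
    finally have r: "norm r \<le> L\<^sub>h * D\<^sup>2" .
    have "d (Suc k) = (1 - \<beta>) *\<^sub>R (d k + r)"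
      unfolding d_def r_def u
      by (simp add: m_Suc increment_def grad_noise_def hess_noise_def blinfun.diff_left blinfun.minus_right
          u_def[symmetric] w_def[symmetric] w'_def[symmetric] algebra_simps)
    then have "norm (d (Suc k)) = (1 - \<beta>) * norm (d k + r)" using \<beta> by simp
    also have "\<dots> \<le> (1 - \<beta>) * (norm (d k) + norm r)"
      using \<beta> by (intro mult_left_mono norm_triangle_ineq) auto
    also have "\<dots> \<le> (1 - \<beta>) * norm (d k) + norm r"
      using \<beta> by (simp add: distrib_left mult_left_le_one_le)
    finally show ?thesis using r by simp
  qed
  then have "norm (d k) \<le> (1 - \<beta>) ^ k * norm (d 0) + L\<^sub>h * D\<^sup>2 / \<beta>"
    using \<beta> Lh by (intro contraction_bound) auto
  then show ?thesis by (simp add: d_def)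
qed

lemma momentum_error:
  "integrable M (\<lambda>\<omega>. norm (m k \<omega> - grad J (z k \<omega>)))"
  "(\<integral>\<omega>. norm (m k \<omega> - grad J (z k \<omega>)) \<partial>M)
     \<le> (1 - \<beta>) ^ k * (\<integral>\<omega>. norm (m 0 \<omega> - grad J (z 0 \<omega>)) \<partial>M) + L\<^sub>h * D\<^sup>2 / \<beta> + sqrt (noise_level / \<beta>)"
proof -
  let ?b = "\<lambda>\<omega>. (1 - \<beta>) ^ k * norm (m 0 \<omega> - grad J (z 0 \<omega>)) + L\<^sub>h * D\<^sup>2 / \<beta>"
  have [measurable]: "noise_sum k \<in> borel_measurable M" using noise_sum_past by (rule past_borel)
  have noise_int: "integrable M (\<lambda>\<omega>. norm (noise_sum k \<omega>))"
    and "(\<integral>\<omega>. norm (noise_sum k \<omega>) \<partial>M) \<le> sqrt (\<integral>\<omega>. (norm (noise_sum k \<omega>))\<^sup>2 \<partial>M)"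
    using expectation_norm_le_sqrt[of "noise_sum k"] noise_sum_second_moment[of k] by auto
  then have noise_le: "(\<integral>\<omega>. norm (noise_sum k \<omega>) \<partial>M) \<le> sqrt (noise_level / \<beta>)"
    using noise_sum_second_moment[of k] by (meson order_trans real_sqrt_le_mono)
  have b_int: "integrable M ?b" using init_int by simp
  have le: "norm (m k \<omega> - grad J (z k \<omega>)) \<le> ?b \<omega> + norm (noise_sum k \<omega>)" for \<omega>
    using norm_triangle_sub[of "m k \<omega> - grad J (z k \<omega>)" "noise_sum k \<omega>"] bias_le[of k \<omega>] by simp
  have bound_int: "integrable M (\<lambda>\<omega>. ?b \<omega> + norm (noise_sum k \<omega>))"
    using b_int noise_int by (rule Bochner_Integration.integrable_add)
  show int: "integrable M (\<lambda>\<omega>. norm (m k \<omega> - grad J (z k \<omega>)))"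
    using bound_int
    by (rule Bochner_Integration.integrable_bound) (use le in \<open>auto intro: order_trans[OF _ abs_ge_self]\<close>)
  have "(\<integral>\<omega>. norm (m k \<omega> - grad J (z k \<omega>)) \<partial>M) \<le> (\<integral>\<omega>. ?b \<omega> + norm (noise_sum k \<omega>) \<partial>M)"
    using int bound_int le by (rule integral_mono)
  also have "\<dots> = (1 - \<beta>) ^ k * (\<integral>\<omega>. norm (m 0 \<omega> - grad J (z 0 \<omega>)) \<partial>M) + L\<^sub>h * D\<^sup>2 / \<beta>
      + (\<integral>\<omega>. norm (noise_sum k \<omega>) \<partial>M)"
    using init_int noise_int by (simp add: prob_space)
  finally show "(\<integral>\<omega>. norm (m k \<omega> - grad J (z k \<omega>)) \<partial>M)
     \<le> (1 - \<beta>) ^ k * (\<integral>\<omega>. norm (m 0 \<omega> - grad J (z 0 \<omega>)) \<partial>M) + L\<^sub>h * D\<^sup>2 / \<beta> + sqrt (noise_level / \<beta>)"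
    using noise_le by simp
qed

text \<open>The transient contributes once, as a geometric series; the floor is paid in every
  iteration.\<close>

lemma sum_momentum_error:
  "(\<Sum>k<T. \<integral>\<omega>. norm (m k \<omega> - grad J (z k \<omega>)) \<partial>M)
     \<le> (\<integral>\<omega>. norm (m 0 \<omega> - grad J (z 0 \<omega>)) \<partial>M) / \<beta> + T * (L\<^sub>h * D\<^sup>2 / \<beta> + sqrt (noise_level / \<beta>))"
proof -
  define E where "E = (\<integral>\<omega>. norm (m 0 \<omega> - grad J (z 0 \<omega>)) \<partial>M)"
  have E: "E \<ge> 0" by (simp add: E_def)
  have "(\<Sum>k<T. \<integral>\<omega>. norm (m k \<omega> - grad J (z k \<omega>)) \<partial>M)
      \<le> (\<Sum>k<T. (1 - \<beta>) ^ k * E + (L\<^sub>h * D\<^sup>2 / \<beta> + sqrt (noise_level / \<beta>)))"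
    using momentum_error(2) by (intro sum_mono) (simp add: E_def add.assoc)
  also have "\<dots> = (\<Sum>k<T. (1 - \<beta>) ^ k) * E + T * (L\<^sub>h * D\<^sup>2 / \<beta> + sqrt (noise_level / \<beta>))"
    by (simp add: sum.distrib sum_distrib_right)
  also have "(\<Sum>k<T. (1 - \<beta>) ^ k) = (1 - (1 - \<beta>) ^ T) / \<beta>"
    using \<beta> by (simp add: sum_gp_strict)
  also have "(1 - (1 - \<beta>) ^ T) / \<beta> * E \<le> 1 / \<beta> * E"
    using \<beta> E by (intro mult_right_mono divide_right_mono) auto
  finally show ?thesis by (simp add: E_def)
qed

end

section \<open>Average stationarity along a run\<close>

text \<open>The minus sign of the descent block is built in, so that the joint iterate is updated by
  adding one vector.\<close>

definition normalized_step :: "real \<Rightarrow> real \<Rightarrow> 'a::euclidean_space \<times> 'b::euclidean_space \<Rightarrow> 'a \<times> 'b" where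
  "normalized_step \<mu>x \<mu>y v
     = (- (\<mu>x *\<^sub>R (fst v /\<^sub>R norm (fst v))), \<mu>y *\<^sub>R (snd v /\<^sub>R norm (snd v)))"

lemma norm_scaled_normalized_le: "(norm (c *\<^sub>R (w /\<^sub>R norm w)))\<^sup>2 \<le> c\<^sup>2"
proof -
  have "(norm (w /\<^sub>R norm w))\<^sup>2 \<le> 1"
    using norm_normalized_le[of w] by (intro power_le_one norm_ge_zero)
  then show ?thesis
    unfolding norm_scaleR[of c] power_mult_distrib power2_abs by (rule mult_left_le) simp
qed

lemma norm_normalized_step_le: "norm (normalized_step \<mu>x \<mu>y v) \<le> sqrt (\<mu>x\<^sup>2 + \<mu>y\<^sup>2)"
  unfolding normalized_step_def norm_Pair norm_minus_cancel
  by (intro real_sqrt_le_mono add_mono norm_scaled_normalized_le)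

lemma borel_measurable_normalized_step: "normalized_step \<mu>x \<mu>y \<in> borel_measurable borel"
proof -
  have [measurable]: "(fst :: 'a \<times> 'b \<Rightarrow> 'a) \<in> borel_measurable borel" "(snd :: 'a \<times> 'b \<Rightarrow> 'b) \<in> borel_measurable borel"
    by (intro borel_measurable_continuous_onI continuous_intros)+
  show ?thesis unfolding normalized_step_def[abs_def] by measurable
qed

lemma hcmm2_position:
  fixes init :: "('m::finite, 'n::finite) hcmm_state"
  assumes s_def: "s = hcmm2 \<mu>x \<mu>y \<beta> \<beta> Q init \<xi>"
  shows "(xvar (s (Suc i)), yvar (s (Suc i)))
    = (xvar (s i), yvar (s i)) + normalized_step \<mu>x \<mu>y (xmom (s i), ymom (s i))"
  by (simp add: s_def hcmm2_step_def Let_def normalized_step_def)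

text \<open>By additivity the four Hessian blocks reassemble into the full Hessian applied to the
  joint displacement, which is the normalised step just taken.\<close>

lemma hcmm2_momentum:
  fixes init :: "('m::finite, 'n::finite) hcmm_state"
  assumes s_def: "s = hcmm2 \<mu>x \<mu>y \<beta> \<beta> Q init \<xi>"
  shows "(xmom (s (Suc i)), ymom (s (Suc i)))
    = (1 - \<beta>) *\<^sub>R ((xmom (s i), ymom (s i))
        + hess (\<lambda>z. Q z (\<xi> (Suc i))) (xvar (s (Suc i)), yvar (s (Suc i)))
            (normalized_step \<mu>x \<mu>y (xmom (s i), ymom (s i))))
      + \<beta> *\<^sub>R grad (\<lambda>z. Q z (\<xi> (Suc i))) (xvar (s (Suc i)), yvar (s (Suc i)))"
proof -
  define w where "w = (xvar (s (Suc i)), yvar (s (Suc i)))"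
  define H where "H = hess (\<lambda>z. Q z (\<xi> (Suc i))) w"
  define u where "u = xvar (s (Suc i)) - xvar (s i)"
  define v where "v = yvar (s (Suc i)) - yvar (s i)"
  have uv: "normalized_step \<mu>x \<mu>y (xmom (s i), ymom (s i)) = (u, v)"
    using hcmm2_position[OF s_def, of i] unfolding u_def v_def by (simp add: prod_eq_iff)
  have H_uv: "blinfun_apply H (u, v) = blinfun_apply H (u, 0) + blinfun_apply H (0, v)"
    unfolding blinfun.add_right[symmetric] by simp
  have step: "s (Suc i) = hcmm2_step \<mu>x \<mu>y \<beta> \<beta> Q (\<xi> (Suc i)) (s i)" by (simp add: s_def)
  have "xmom (s (Suc i)) = (1 - \<beta>) *\<^sub>R (xmom (s i) + fst (blinfun_apply H (u, 0)) + fst (blinfun_apply H (0, v)))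
      + \<beta> *\<^sub>R fst (grad (\<lambda>z. Q z (\<xi> (Suc i))) w)"
    and "ymom (s (Suc i)) = (1 - \<beta>) *\<^sub>R (ymom (s i) + snd (blinfun_apply H (0, v)) + snd (blinfun_apply H (u, 0)))
      + \<beta> *\<^sub>R snd (grad (\<lambda>z. Q z (\<xi> (Suc i))) w)"
    unfolding H_def u_def v_def w_def unfolding step
    by (simp_all add: hcmm2_step_def Let_def hess_xx_def hess_xy_def hess_yx_def hess_yy_def
        grad_x_def grad_y_def)
  then show ?thesis
    unfolding w_def[symmetric] H_def[symmetric] uv H_uv by (simp add: prod_eq_iff add_ac)
qed

lemma calls_hcmm2: "calls (hcmm2 \<mu>x \<mu>y \<beta>x \<beta>y Q init \<xi> i) = calls init + 6 * i"
  by (induction i) (simp_all add: hcmm2_step_def Let_def)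

context pl_saddle
begin

text \<open>Linear in the gaps, by \<open>t \<le> 1 + t\<^sup>2\<close>: integrability of
  \<open>primal J\<close> and \<open>J\<close> at the initial point thereby gives integrability of
  the initial gradient.\<close>

lemma norm_grad_le_gaps:
  assumes B: "\<And>v. B \<le> primal J v"
  shows "norm (grad J (u, y))
    \<le> (1 + 4 * smoothness * (primal J u - B)) + (1 + 2 * \<kappa>) * (1 + 4 * L * (primal J u - J (u, y)))"
proof -
  have le: "t \<le> 1 + t\<^sup>2" if "t \<ge> 0" for t :: real
    using sum_squares_bound[of 1 t] that by simp
  have gy: "norm (grad_y J (u, y)) \<le> 1 + 4 * L * (primal J u - J (u, y))"
    using le[of "norm (grad_y J (u, y))"] norm_grad_y_le[of u y] by simp
  have gP: "norm (grad (primal J) u) \<le> 1 + 4 * smoothness * (primal J u - B)"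
    using le[of "norm (grad (primal J) u)"] norm_grad_primal_le[OF B, of u] by simp
  have "norm (grad J (u, y)) \<le> norm (grad_x J (u, y)) + norm (grad_y J (u, y))"
    using norm_Pair_le[of "fst (grad J (u, y))" "snd (grad J (u, y))"] by (simp add: grad_x_def grad_y_def)
  also have "norm (grad_x J (u, y)) \<le> norm (grad (primal J) u) + 2 * \<kappa> * norm (grad_y J (u, y))"
    using norm_triangle_sub[of "grad_x J (u, y)" "grad (primal J) u"] grad_x_primal_diff_le[of u y] by simp
  also have "norm (grad (primal J) u) + 2 * \<kappa> * norm (grad_y J (u, y)) + norm (grad_y J (u, y))
      = norm (grad (primal J) u) + (1 + 2 * \<kappa>) * norm (grad_y J (u, y))" by (simp add: algebra_simps)
  also have "\<dots> \<le> (1 + 4 * smoothness * (primal J u - B)) + (1 + 2 * \<kappa>) * (1 + 4 * L * (primal J u - J (u, y)))"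
    using gP gy kappa_pos by (intro add_mono mult_left_mono) auto
  finally show ?thesis by simp
qed

end

section \<open>Telescoping the descent along a run\<close>

locale hcmm_run = pl_saddle J L \<nu> \<kappa>
    + momentum_run M S \<xi> X\<^sub>0 Q J z m "normalized_step \<mu>x \<mu>y" \<beta> "sqrt (\<mu>x\<^sup>2 + \<mu>y\<^sup>2)" \<sigma> \<sigma>h L\<^sub>h
  for J :: "'a::euclidean_space \<times> 'b::euclidean_space \<Rightarrow> real" and L \<nu> \<kappa> :: real
    and M :: "'w measure" and S :: "'s measure" and \<xi> and X\<^sub>0 :: "'w \<Rightarrow> 'c::topological_space"
    and Q and z m and \<mu>x \<mu>y \<beta> \<sigma> \<sigma>h L\<^sub>h :: real +
  fixes B :: real
  assumes B: "\<And>u. B \<le> primal J u"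
    and \<mu>x: "0 < \<mu>x" "6 * \<kappa> * \<mu>x \<le> \<mu>y" and \<mu>y: "0 < \<mu>y"
    and lyapunov_int: "integrable M (\<lambda>\<omega>. 2 * primal J (fst (z 0 \<omega>)) - J (z 0 \<omega>))"
begin

abbreviation "stationarity k \<omega> \<equiv> norm (grad (primal J) (fst (z k \<omega>)))"

abbreviation "deviation k \<omega> \<equiv> norm (m k \<omega> - grad J (z k \<omega>))"

definition curvature :: real where
  "curvature = (2 * smoothness + L) * (\<mu>x\<^sup>2 + \<mu>y\<^sup>2)"

lemma stationarity_step:
  "\<mu>x * stationarity k \<omega> \<le> lyapunov (z k \<omega>) - lyapunov (z (Suc k) \<omega>)
     + 2 * (\<mu>x + \<mu>y) * deviation k \<omega> + curvature"
  using lyapunov_step[of \<mu>x \<mu>y "z k \<omega>" "m k \<omega>"] \<mu>x \<mu>y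
  by (simp add: z_Suc normalized_step_def curvature_def)

text \<open>Kept pathwise, because integrability of the gradient norms is itself deduced from this
  bound. Replacing the final Lyapunov value by \<open>B\<close> leaves only the initial one to be
  integrated.\<close>

lemma sum_stationarity:
  "\<mu>x * (\<Sum>k<n. stationarity k \<omega>) \<le> lyapunov (z 0 \<omega>) - B
     + 2 * (\<mu>x + \<mu>y) * (\<Sum>k<n. deviation k \<omega>) + n * curvature"
proof -
  have "\<mu>x * (\<Sum>k<n. stationarity k \<omega>)
      \<le> (\<Sum>k<n. (lyapunov (z k \<omega>) - lyapunov (z (Suc k) \<omega>)) + 2 * (\<mu>x + \<mu>y) * deviation k \<omega> + curvature)"
    unfolding sum_distrib_left by (intro sum_mono stationarity_step)
  also have "\<dots> = lyapunov (z 0 \<omega>) - lyapunov (z n \<omega>) + 2 * (\<mu>x + \<mu>y) * (\<Sum>k<n. deviation k \<omega>) + n * curvature"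
    by (simp only: sum.distrib sum_lessThan_telescope'[of "\<lambda>k. lyapunov (z k \<omega>)"] sum_distrib_left
        sum_constant card_lessThan)
  finally show ?thesis
    using B[of "fst (z n \<omega>)"] primal_le_lyapunov[of "z n \<omega>"] by simp
qed

lemma lyapunov_integrable: "integrable M (\<lambda>\<omega>. lyapunov (z 0 \<omega>))"
  using lyapunov_int by (simp add: lyapunov_def)

lemma stationarity_integrable: "integrable M (stationarity k)"
proof -
  let ?r = "\<lambda>\<omega>. (lyapunov (z 0 \<omega>) - B + 2 * (\<mu>x + \<mu>y) * (\<Sum>j<Suc k. deviation j \<omega>) + Suc k * curvature) / \<mu>x"
  have "integrable M ?r"
    using lyapunov_integrable momentum_error(1)
    by (intro integrable_divide Bochner_Integration.integrable_add Bochner_Integration.integrable_diff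
        integrable_mult_right Bochner_Integration.integrable_sum) auto
  then show ?thesis
  proof (rule Bochner_Integration.integrable_bound)
    have "(\<lambda>w::'a \<times> 'b. grad (primal J) (fst w)) \<in> borel_measurable borel"
      by (intro borel_measurable_continuous_onI continuous_on_compose2[OF
          lipschitz_on_continuous_on[OF grad_primal_lipschitz] continuous_on_fst]) (auto intro: continuous_intros)
    from measurable_compose[OF z_borel this] show "stationarity k \<in> borel_measurable M" by measurable
    have "stationarity k \<omega> \<le> ?r \<omega>" for \<omega>
    proof -
      have "stationarity k \<omega> \<le> (\<Sum>j<Suc k. stationarity j \<omega>)"
        by (simp add: sum_nonneg)
      then have "\<mu>x * stationarity k \<omega> \<le> \<mu>x * (\<Sum>j<Suc k. stationarity j \<omega>)"
        using \<mu>x by (intro mult_left_mono) auto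
      with sum_stationarity[where n = "Suc k" and \<omega> = \<omega>] show ?thesis
        using \<mu>x by (simp only: pos_le_divide_eq mult.commute[of _ \<mu>x])
    qed
    then show "AE \<omega> in M. norm (stationarity k \<omega>) \<le> norm (?r \<omega>)"
      by (intro AE_I2) (simp only: real_norm_def abs_norm_cancel order_trans[OF _ abs_ge_self])
  qed
qed

lemma sum_expectation_stationarity:
  "\<mu>x * (\<Sum>k<n. \<integral>\<omega>. stationarity k \<omega> \<partial>M) \<le> (\<integral>\<omega>. lyapunov (z 0 \<omega>) \<partial>M) - B
     + 2 * (\<mu>x + \<mu>y) * ((\<integral>\<omega>. deviation 0 \<omega> \<partial>M) / \<beta>
         + n * (L\<^sub>h * (\<mu>x\<^sup>2 + \<mu>y\<^sup>2) / \<beta> + sqrt (noise_level / \<beta>))) + n * curvature"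
proof -
  have "\<mu>x * (\<Sum>k<n. \<integral>\<omega>. stationarity k \<omega> \<partial>M) = (\<integral>\<omega>. \<mu>x * (\<Sum>k<n. stationarity k \<omega>) \<partial>M)"
    using stationarity_integrable by (simp add: Bochner_Integration.integral_sum)
  also have "\<dots> \<le> (\<integral>\<omega>. lyapunov (z 0 \<omega>) - B + 2 * (\<mu>x + \<mu>y) * (\<Sum>k<n. deviation k \<omega>) + n * curvature \<partial>M)"
    using stationarity_integrable lyapunov_integrable momentum_error(1) sum_stationarity
    by (intro integral_mono Bochner_Integration.integrable_add Bochner_Integration.integrable_diff
        integrable_mult_right Bochner_Integration.integrable_sum) auto
  also have "\<dots> = (\<integral>\<omega>. lyapunov (z 0 \<omega>) \<partial>M) - B
      + 2 * (\<mu>x + \<mu>y) * (\<Sum>k<n. \<integral>\<omega>. deviation k \<omega> \<partial>M) + n * curvature"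
    using lyapunov_integrable momentum_error(1)
    by (simp add: Bochner_Integration.integral_sum prob_space)
  also have "2 * (\<mu>x + \<mu>y) * (\<Sum>k<n. \<integral>\<omega>. deviation k \<omega> \<partial>M)
      \<le> 2 * (\<mu>x + \<mu>y) * ((\<integral>\<omega>. deviation 0 \<omega> \<partial>M) / \<beta>
         + n * (L\<^sub>h * (sqrt (\<mu>x\<^sup>2 + \<mu>y\<^sup>2))\<^sup>2 / \<beta> + sqrt (noise_level / \<beta>)))"
    using sum_momentum_error[of n] \<mu>x \<mu>y by (intro mult_left_mono) auto
  finally show ?thesis by simp
qed

end

text \<open>With \<open>t\<close> the inverse cube root of \<open>T\<close>, step size and smoothing
  are comparable to \<open>t\<^sup>2\<close>, and every quotient becomes a power of
  \<open>t\<close>: \<open>C / (T * \<mu>)\<close>, \<open>E / (T * \<beta>)\<close> and the noise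
  root are of order \<open>t\<close>, the Taylor and curvature terms of order
  \<open>t\<^sup>2\<close>.\<close>

lemma rate_arithmetic:
  fixes t a b c \<mu> \<beta> C E Lh K s sh T :: real
  assumes t: "0 < t" "t \<le> 1" and T: "T = 1 / t ^ 3" and a: "0 < a"
    and \<mu>: "a * t\<^sup>2 \<le> \<mu>" "\<mu> \<le> b * t\<^sup>2" and \<beta>: "a * t\<^sup>2 \<le> \<beta>" "\<beta> \<le> b * t\<^sup>2"
    and c: "0 < c" "c < 1"
    and nonneg: "0 \<le> C" "0 \<le> E" "0 \<le> Lh" "0 \<le> K"
  shows "(C + 2 * (c * \<mu> + \<mu>) * (E / \<beta> + T * (Lh * ((c * \<mu>)\<^sup>2 + \<mu>\<^sup>2) / \<beta>
            + sqrt (2 * ((sh * sqrt ((c * \<mu>)\<^sup>2 + \<mu>\<^sup>2))\<^sup>2 + (\<beta> * s)\<^sup>2) / \<beta>)))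
            + T * (K * ((c * \<mu>)\<^sup>2 + \<mu>\<^sup>2))) / (T * (c * \<mu>))
      \<le> (C / (c * a) + 4 / c * (E / a + 2 * Lh * b\<^sup>2 / a + sqrt (2 * (2 * sh\<^sup>2 * b\<^sup>2 + b\<^sup>2 * s\<^sup>2) / a))
            + 2 * K * b / c) * t"
proof -
  define D where "D = (c * \<mu>)\<^sup>2 + \<mu>\<^sup>2"
  have at: "0 < a * t\<^sup>2" using a t by simp
  have \<mu>pos: "0 < \<mu>" and \<beta>pos: "0 < \<beta>" and Tpos: "0 < T" using at \<mu> \<beta> t T by auto
  have bt: "0 < b * t\<^sup>2" using \<mu>pos \<mu> by simp
  have b: "0 < b" using bt t by (simp add: zero_less_mult_iff)
  have D0: "0 \<le> D" by (simp add: D_def)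
  have D\<mu>: "D \<le> 2 * \<mu>\<^sup>2"
    using c mult_right_mono[of "c\<^sup>2" 1 "\<mu>\<^sup>2"] by (simp add: D_def power_mult_distrib power_le_one)
  have \<mu>sq: "\<mu>\<^sup>2 \<le> b\<^sup>2 * t ^ 4" and \<beta>sq: "\<beta>\<^sup>2 \<le> b\<^sup>2 * t ^ 4"
    using power_mono[OF \<mu>(2), of 2] power_mono[OF \<beta>(2), of 2] \<mu>pos \<beta>pos
    by (simp_all add: power_mult_distrib flip: power_mult)
  have Db: "D \<le> 2 * b\<^sup>2 * t ^ 4" using D\<mu> \<mu>sq by simp
  \<comment> \<open>Squares of the parameters are of order \<open>t ^ 4\<close>; the lower bound on
    \<open>\<beta>\<close> removes two of these powers.\<close>
  have over_\<beta>: "x / \<beta> \<le> y / a * t\<^sup>2" if "x \<le> y * t ^ 4" "0 \<le> x" for x y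
  proof -
    have "x / \<beta> \<le> x / (a * t\<^sup>2)" using that at \<beta> by (intro divide_left_mono) auto
    also have "\<dots> \<le> y * t ^ 4 / (a * t\<^sup>2)" using that at by (intro divide_right_mono) auto
    also have "\<dots> = y / a * t\<^sup>2" using t by (simp add: eval_nat_numeral)
    finally show ?thesis .
  qed
  have t2: "t\<^sup>2 \<le> t" using t by (simp add: power2_eq_square mult_left_le_one_le)
  have over_T: "x / (T * y) \<le> x / a * t" if "0 \<le> x" "a * t\<^sup>2 \<le> y" for x y
  proof -
    have "x / (T * y) \<le> x / (T * (a * t\<^sup>2))"
      using that at Tpos by (intro divide_left_mono mult_left_mono) auto
    also have "\<dots> = x / a * t" using t by (simp add: T eval_nat_numeral)
    finally show ?thesis .
  qed
  \<comment> \<open>Since \<open>\<mu>x\<close> is proportional to \<open>\<mu>y\<close>, the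
    prefactor \<open>2 * (c * \<mu> + \<mu>) / (c * \<mu>)\<close> does not depend on
    \<open>\<mu>\<close>; with \<open>c < 1\<close> it is at most \<open>4 / c\<close>.\<close>
  have "(C + 2 * (c * \<mu> + \<mu>) * (E / \<beta> + T * (Lh * D / \<beta>
            + sqrt (2 * ((sh * sqrt D)\<^sup>2 + (\<beta> * s)\<^sup>2) / \<beta>))) + T * (K * D)) / (T * (c * \<mu>))
      = C / (T * \<mu>) / c + 2 * (c + 1) / c * (E / (T * \<beta>) + Lh * D / \<beta>
            + sqrt (2 * ((sh * sqrt D)\<^sup>2 + (\<beta> * s)\<^sup>2) / \<beta>)) + K * (D / \<mu>) / c"
    using \<mu>pos \<beta>pos Tpos c by (simp add: field_simps)
  also have "\<dots> \<le> C / a * t / c + 4 / c * (E / a * t + 2 * Lh * b\<^sup>2 / a * t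
            + sqrt (2 * (2 * sh\<^sup>2 * b\<^sup>2 + b\<^sup>2 * s\<^sup>2) / a) * t) + K * (2 * b * t) / c"
  proof (intro add_mono divide_right_mono mult_mono mult_left_mono)
    show "C / (T * \<mu>) \<le> C / a * t" using nonneg \<mu> by (intro over_T)
    show "E / (T * \<beta>) \<le> E / a * t" using nonneg \<beta> by (intro over_T)
    show "Lh * D / \<beta> \<le> 2 * Lh * b\<^sup>2 / a * t"
    proof -
      have "Lh * D / \<beta> \<le> 2 * Lh * b\<^sup>2 / a * t\<^sup>2"
        using mult_left_mono[OF Db nonneg(3)] D0 nonneg by (intro over_\<beta>) (simp_all add: mult_ac)
      also have "\<dots> \<le> 2 * Lh * b\<^sup>2 / a * t" using t2 a nonneg by (intro mult_left_mono) auto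
      finally show ?thesis .
    qed
    show "sqrt (2 * ((sh * sqrt D)\<^sup>2 + (\<beta> * s)\<^sup>2) / \<beta>) \<le> sqrt (2 * (2 * sh\<^sup>2 * b\<^sup>2 + b\<^sup>2 * s\<^sup>2) / a) * t"
    proof (rule real_le_lsqrt)
      have "sh\<^sup>2 * D \<le> sh\<^sup>2 * (2 * b\<^sup>2 * t ^ 4)" and "\<beta>\<^sup>2 * s\<^sup>2 \<le> b\<^sup>2 * t ^ 4 * s\<^sup>2"
        using Db \<beta>sq by (auto intro: mult_left_mono mult_right_mono)
      then have "2 * ((sh * sqrt D)\<^sup>2 + (\<beta> * s)\<^sup>2) \<le> 2 * (2 * sh\<^sup>2 * b\<^sup>2 + b\<^sup>2 * s\<^sup>2) * t ^ 4"
        using D0 by (simp add: power_mult_distrib algebra_simps)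
      then have "2 * ((sh * sqrt D)\<^sup>2 + (\<beta> * s)\<^sup>2) / \<beta> \<le> 2 * (2 * sh\<^sup>2 * b\<^sup>2 + b\<^sup>2 * s\<^sup>2) / a * t\<^sup>2"
        by (rule over_\<beta>) simp
      also have "\<dots> = (sqrt (2 * (2 * sh\<^sup>2 * b\<^sup>2 + b\<^sup>2 * s\<^sup>2) / a) * t)\<^sup>2"
        using a by (simp add: power_mult_distrib)
      finally show "2 * ((sh * sqrt D)\<^sup>2 + (\<beta> * s)\<^sup>2) / \<beta> \<le> (sqrt (2 * (2 * sh\<^sup>2 * b\<^sup>2 + b\<^sup>2 * s\<^sup>2) / a) * t)\<^sup>2" .
    qed (use t a in auto)
    show "D / \<mu> \<le> 2 * b * t"
    proof -
      have "D / \<mu> \<le> 2 * \<mu>" using D\<mu> \<mu>pos by (simp add: divide_le_eq power2_eq_square)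
      also have "\<dots> \<le> 2 * b * t\<^sup>2" using \<mu> by simp
      also have "\<dots> \<le> 2 * b * t" using t2 b by simp
      finally show ?thesis .
    qed
    show "2 * (c + 1) \<le> 4" using c by simp
  qed (use nonneg c Tpos \<mu>pos \<beta>pos D0 in \<open>auto intro!: add_nonneg_nonneg\<close>)
  also have "\<dots> = (C / (c * a) + 4 / c * (E / a + 2 * Lh * b\<^sup>2 / a + sqrt (2 * (2 * sh\<^sup>2 * b\<^sup>2 + b\<^sup>2 * s\<^sup>2) / a))
            + 2 * K * b / c) * t"
    using c a by (simp add: field_simps)
  finally show ?thesis by (simp only: D_def)
qed

text \<open>Randomised output rule: an index drawn uniformly and independently of the run turns a
  bound on the average into a bound for one returned point.\<close>

lemma (in prob_space) expectation_uniform_index: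
  fixes f :: "nat \<Rightarrow> 'a \<Rightarrow> real"
  assumes int: "\<And>i. integrable M (f i)" and n: "n \<ge> 1"
  shows "integrable (M \<Otimes>\<^sub>M measure_pmf (pmf_of_set {..<n})) (\<lambda>(\<omega>, i). f i \<omega>)"
    and "(\<integral>(\<omega>, i). f i \<omega> \<partial>(M \<Otimes>\<^sub>M measure_pmf (pmf_of_set {..<n}))) = 1 / n * (\<Sum>i<n. \<integral>\<omega>. f i \<omega> \<partial>M)"
proof -
  let ?p = "pmf_of_set {..<n}"
  interpret pair_sigma_finite M "measure_pmf ?p" ..
  have ne: "{..<n} \<noteq> {}" using n by (simp add: lessThan_empty_iff)
  have mean: "(\<integral>i. g i \<partial>measure_pmf ?p) = (\<Sum>i<n. g i) / n" for g :: "nat \<Rightarrow> real"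
    using ne by (subst integral_pmf_of_set) auto
  have [measurable]: "f i \<in> borel_measurable M" for i
    using int by (rule borel_measurable_integrable)
  have meas: "(\<lambda>(\<omega>, i). f i \<omega>) \<in> borel_measurable (M \<Otimes>\<^sub>M measure_pmf ?p)"
    unfolding case_prod_beta' by (rule measurable_compose_countable[where f = "\<lambda>i p. f i (fst p)"]) simp_all
  show prod: "integrable (M \<Otimes>\<^sub>M measure_pmf ?p) (\<lambda>(\<omega>, i). f i \<omega>)"
  proof (rule Fubini_integrable[OF meas])
    show "integrable M (\<lambda>\<omega>. \<integral>i. norm (case (\<omega>, i) of (\<omega>, i) \<Rightarrow> f i \<omega>) \<partial>measure_pmf ?p)"
      using int by (simp add: mean)
    show "AE \<omega> in M. integrable (measure_pmf ?p) (\<lambda>i. case (\<omega>, i) of (\<omega>, i) \<Rightarrow> f i \<omega>)"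
      using ne by (intro AE_I2 integrable_measure_pmf_finite) simp
  qed
  show "(\<integral>(\<omega>, i). f i \<omega> \<partial>(M \<Otimes>\<^sub>M measure_pmf ?p)) = 1 / n * (\<Sum>i<n. \<integral>\<omega>. f i \<omega> \<partial>M)"
    using integral_fst'[OF prod] int by (simp add: mean Bochner_Integration.integral_sum)
qed

section \<open>Convergence rate and complexity\<close>

text \<open>The lower bound matters as much as the upper one, since both parameters also occur in
  denominators. Positivity removes the absolute values of the asymptotic statement.\<close>

lemma bigtheta_powr_bounds:
  fixes f :: "nat \<Rightarrow> real"
  assumes f: "f \<in> \<Theta>(\<lambda>T. 1 / real T powr (2 / 3))" and pos: "\<And>T. T \<ge> 1 \<Longrightarrow> f T > 0"
  obtains a b where "0 < a" and "\<forall>\<^sub>F T in sequentially.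
    a * (1 / real T powr (1 / 3))\<^sup>2 \<le> f T \<and> f T \<le> b * (1 / real T powr (1 / 3))\<^sup>2"
proof -
  have g: "(1 / real T powr (1 / 3))\<^sup>2 = 1 / real T powr (2 / 3)" for T
    by (simp add: power_one_over power2_eq_square flip: powr_add)
  obtain b where b: "\<forall>\<^sub>F T in sequentially. norm (f T) \<le> b * norm (1 / real T powr (2 / 3))"
    using landau_o.bigE[OF bigthetaD1[OF f]] by metis
  obtain a where a: "a > 0" "\<forall>\<^sub>F T in sequentially. norm (f T) \<ge> a * norm (1 / real T powr (2 / 3))"
    using landau_omega.bigE[OF bigthetaD2[OF f]] by metis
  show thesis
  proof (rule that[OF a(1)])
    show "\<forall>\<^sub>F T in sequentially.
        a * (1 / real T powr (1 / 3))\<^sup>2 \<le> f T \<and> f T \<le> b * (1 / real T powr (1 / 3))\<^sup>2"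
      using a(2) b eventually_ge_at_top[of 1]
    proof eventually_elim
      case (elim T)
      then show ?case using pos[of T] by (simp add: g)
    qed
  qed
qed

lemma cubic_iteration_complexity:
  fixes A :: "nat \<Rightarrow> real"
  assumes rate: "\<And>T. T \<ge> T0 \<Longrightarrow> A T \<le> K * (1 / real T powr (1 / 3))" and "K > 0" "T0 \<ge> 1"
  shows "\<exists>N :: real \<Rightarrow> nat. (\<lambda>\<epsilon>. real (N \<epsilon>)) \<in> O[at_right 0](\<lambda>\<epsilon>. 1 / \<epsilon> ^ 3) \<and>
    (\<forall>\<epsilon>>0. N \<epsilon> \<ge> 1 \<and> A (N \<epsilon>) \<le> \<epsilon>)"
proof -
  \<comment> \<open>Solving \<open>K / T powr (1 / 3) \<le> \<epsilon>\<close> for \<open>T\<close>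
    gives the cube of \<open>K / \<epsilon>\<close>; the maximum with \<open>T0\<close> reaches the
    range where the rate is available.\<close>
  define N where "N \<epsilon> = max T0 (nat \<lceil>(K / \<epsilon>) ^ 3\<rceil>)" for \<epsilon> :: real
  have "A (N \<epsilon>) \<le> \<epsilon>" if \<epsilon>: "\<epsilon> > 0" for \<epsilon>
  proof -
    have KE: "0 < K / \<epsilon>" using \<epsilon> \<open>K > 0\<close> by simp
    have "(K / \<epsilon>) ^ 3 \<le> real (nat \<lceil>(K / \<epsilon>) ^ 3\<rceil>)" by (rule real_nat_ceiling_ge)
    also have "\<dots> \<le> real (N \<epsilon>)" by (simp add: N_def)
    finally have "((K / \<epsilon>) ^ 3) powr (1 / 3) \<le> real (N \<epsilon>) powr (1 / 3)"
      using KE by (intro powr_mono2) auto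
    moreover have "((K / \<epsilon>) ^ 3) powr (1 / 3) = K / \<epsilon>"
      using KE powr_realpow[of "K / \<epsilon>" 3] powr_powr[of "K / \<epsilon>" 3 "1 / 3"] \<epsilon> \<open>K > 0\<close> by simp
    ultimately have root: "K / \<epsilon> \<le> real (N \<epsilon>) powr (1 / 3)" by simp
    have "A (N \<epsilon>) \<le> K * (1 / real (N \<epsilon>) powr (1 / 3))"
      by (rule rate) (simp add: N_def)
    also have "\<dots> \<le> \<epsilon>"
      using root less_le_trans[OF KE root] \<epsilon> by (simp add: field_simps)
    finally show ?thesis .
  qed
  moreover have "N \<epsilon> \<ge> 1" for \<epsilon> using \<open>T0 \<ge> 1\<close> by (simp add: N_def)
  moreover have "(\<lambda>\<epsilon>. real (N \<epsilon>)) \<in> O[at_right 0](\<lambda>\<epsilon>. 1 / \<epsilon> ^ 3)"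
  proof (rule bigoI)
    have "\<forall>\<^sub>F \<epsilon> in at_right 0. \<epsilon> \<in> {0<..<1::real}"
      by (rule eventually_at_right_real) simp
    then show "\<forall>\<^sub>F \<epsilon> in at_right 0. norm (real (N \<epsilon>)) \<le> (real T0 + 1 + K ^ 3) * norm (1 / \<epsilon> ^ 3)"
    proof eventually_elim
      case (elim \<epsilon>)
      have "real (N \<epsilon>) \<le> real T0 + real (nat \<lceil>(K / \<epsilon>) ^ 3\<rceil>)" by (simp add: N_def)
      also have "real (nat \<lceil>(K / \<epsilon>) ^ 3\<rceil>) \<le> (K / \<epsilon>) ^ 3 + 1"
      proof -
        have "real (nat \<lceil>r\<rceil>) \<le> r + 1" if "0 \<le> r" for r :: real using that by linarith
        then show ?thesis using elim \<open>K > 0\<close> by simp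
      qed
      \<comment> \<open>Near 0 the additive constants are absorbed, because
        \<open>1 \<le> 1 / \<epsilon> ^ 3\<close>.\<close>
      also have "real T0 + ((K / \<epsilon>) ^ 3 + 1) \<le> (real T0 + 1) * (1 / \<epsilon> ^ 3) + K ^ 3 * (1 / \<epsilon> ^ 3)"
      proof -
        have "1 \<le> 1 / \<epsilon> ^ 3" using elim by (simp add: power_le_one)
        then have "(real T0 + 1) * 1 \<le> (real T0 + 1) * (1 / \<epsilon> ^ 3)" by (intro mult_left_mono) auto
        then show ?thesis by (simp add: power_divide)
      qed
      finally show ?case using elim by (simp add: add_divide_distrib)
    qed
  qed
  ultimately show ?thesis by blast
qed

theorem theorem2:
  fixes M :: "'w measure" and S :: "'s measure"
    and Q :: "(real ^ 'm::finite) \<times> (real ^ 'n::finite) \<Rightarrow> 's \<Rightarrow> real"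
    and J :: "(real ^ 'm) \<times> (real ^ 'n) \<Rightarrow> real"
    and \<xi> :: "nat \<Rightarrow> 'w \<Rightarrow> 's"
    and x0 mx0 :: "'w \<Rightarrow> real ^ 'm" and y0 my0 :: "'w \<Rightarrow> real ^ 'n"
    and L\<^sub>f L\<^sub>h \<nu> \<kappa> \<sigma> \<sigma>h c\<^sub>3 :: real
    and \<mu>x \<mu>y \<beta>x \<beta>y :: "nat \<Rightarrow> real"
    and st :: "nat \<Rightarrow> nat \<Rightarrow> 'w \<Rightarrow> ('m, 'n) hcmm_state"
    and x :: "nat \<Rightarrow> nat \<Rightarrow> 'w \<Rightarrow> real ^ 'm"
    and z :: "nat \<Rightarrow> nat \<Rightarrow> 'w \<Rightarrow> (real ^ 'm) \<times> (real ^ 'n)"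
  assumes prob: "prob_space M"
    \<comment> \<open>objective\<close>
    and Q_diff: "\<And>s. s \<in> space S \<Longrightarrow> twice_differentiable (\<lambda>z. Q z s)"
    and Q_grad_meas: "(\<lambda>(z, s). grad (\<lambda>z. Q z s) z) \<in> borel_measurable (borel \<Otimes>\<^sub>M S)"
    and Q_hess_meas: "\<And>u. (\<lambda>(z, s). blinfun_apply (hess (\<lambda>z. Q z s) z) u)
                        \<in> borel_measurable (borel \<Otimes>\<^sub>M S)"
    and J_expect: "\<And>w i. i \<ge> 1 \<Longrightarrow>
          integrable M (\<lambda>\<omega>. Q w (\<xi> i \<omega>)) \<and> J w = (\<integral>\<omega>. Q w (\<xi> i \<omega>) \<partial>M)"
    and J_diff: "twice_differentiable J"
    and J_max: "max_attained J"
    and nu_pos: "\<nu> > 0"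
    and PL: "\<And>u v. (norm (grad_y J (u, v)))\<^sup>2 \<ge> 2 * \<nu> * (primal J u - J (u, v))"
    and P_bdd: "bdd_below (range (primal J))"
    and Lf_pos: "L\<^sub>f > 0"
    and grad_lip: "L\<^sub>f-lipschitz_on UNIV (grad J)"
    and hess_lip: "L\<^sub>h-lipschitz_on UNIV (hess J)"
    and kappa: "\<kappa> = L\<^sub>f / \<nu>"
    \<comment> \<open>samples and initial data\<close>
    and samples_indep: "prob_space.indep_vars M (\<lambda>_. S) \<xi> {1..}"
    and init_indep: "prob_space.indep_set M
          {(\<lambda>\<omega>. ((x0 \<omega>, y0 \<omega>), (mx0 \<omega>, my0 \<omega>))) -` A \<inter> space M | A. A \<in> sets borel}
          {(\<lambda>\<omega>. \<lambda>i\<in>{1..}. \<xi> i \<omega>) -` B \<inter> space M | B. B \<in> sets (PiM {1..} (\<lambda>_. S))}"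
    and init_int: "integrable M (\<lambda>\<omega>. primal J (x0 \<omega>))"
                  "integrable M (\<lambda>\<omega>. J (x0 \<omega>, y0 \<omega>))"
                  "integrable M mx0" "integrable M my0"
    \<comment> \<open>the run for each number of iterations \<open>T\<close>\<close>
    and st: "\<And>T i \<omega>. st T i \<omega> = hcmm2 (\<mu>x T) (\<mu>y T) (\<beta>x T) (\<beta>y T) Q
               \<lparr>xvar = x0 \<omega>, yvar = y0 \<omega>, xmom = mx0 \<omega>, ymom = my0 \<omega>, calls = 0\<rparr>
               (\<lambda>k. \<xi> k \<omega>) i"
    and x: "\<And>T i \<omega>. x T i \<omega> = xvar (st T i \<omega>)"
    and z: "\<And>T i \<omega>. z T i \<omega> = (xvar (st T i \<omega>), yvar (st T i \<omega>))"
    and noise: "\<And>T i. T \<ge> 1 \<Longrightarrow> i \<ge> 1 \<Longrightarrow> unbiased_bounded_noise M Q J \<sigma> \<sigma>h (z T) \<xi> i"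
    \<comment> \<open>hyperparameters\<close>
    and params_pos: "\<And>T. T \<ge> 1 \<Longrightarrow> \<mu>y T > 0 \<and> \<beta>x T > 0"
    and stab_beta: "\<And>T. T \<ge> 1 \<Longrightarrow> \<beta>x T = \<beta>y T \<and> \<beta>y T \<le> 1"
    and stab_mu: "\<And>T. T \<ge> 1 \<Longrightarrow> \<mu>x T \<le> min (\<mu>y T) (\<mu>y T / (6 * \<kappa>))"
    and c3: "0 < c\<^sub>3" "c\<^sub>3 < 1" "\<And>T. T \<ge> 1 \<Longrightarrow> \<mu>x T = c\<^sub>3 * \<mu>y T"
    and beta_rate: "\<beta>x \<in> \<Theta>(\<lambda>T. 1 / real T powr (2 / 3))"
    and mu_rate: "\<mu>y \<in> \<Theta>(\<lambda>T. 1 / real T powr (2 / 3))"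
  shows "(\<forall>u. \<exists>D. GDERIV (primal J) u :> D) \<and>
    (\<forall>T i. T \<ge> 1 \<longrightarrow> i < T \<longrightarrow> integrable M (\<lambda>\<omega>. norm (grad (primal J) (x T i \<omega>)))) \<and>
    (\<exists>r1 r2 r3 :: nat \<Rightarrow> real.
        r1 \<in> O(\<lambda>T. 1 / real T powr (1 / 3)) \<and>
        r2 \<in> O(\<lambda>T. 1 / real T) \<and>
        r3 \<in> O(\<lambda>T. 1 / real T powr (2 / 3)) \<and>
        (\<forall>T\<ge>1. 1 / real T * (\<Sum>i<T. \<integral>\<omega>. norm (grad (primal J) (x T i \<omega>)) \<partial>M)
                  \<le> r1 T + r2 T + r3 T)) \<and>
    (\<exists>N C :: real \<Rightarrow> nat.
        (\<lambda>\<epsilon>. real (N \<epsilon>)) \<in> O[at_right 0](\<lambda>\<epsilon>. 1 / \<epsilon> ^ 3) \<and>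
        (\<lambda>\<epsilon>. real (C \<epsilon>)) \<in> O[at_right 0](\<lambda>\<epsilon>. 1 / \<epsilon> ^ 3) \<and>
        (\<forall>\<epsilon>>0. N \<epsilon> \<ge> 1 \<and>
           (\<forall>\<omega>\<in>space M. calls (st (N \<epsilon>) (N \<epsilon>) \<omega>) \<le> C \<epsilon>) \<and>
           (\<exists>i<N \<epsilon>. stationary_point M (primal J) \<epsilon> (x (N \<epsilon>) i)) \<and>
           stationary_point (M \<Otimes>\<^sub>M measure_pmf (pmf_of_set {..<N \<epsilon>})) (primal J) \<epsilon>
             (\<lambda>(\<omega>, i). x (N \<epsilon>) i \<omega>)))"
proof -
  interpret prob_space M by (rule prob)
  interpret P: pl_saddle J L\<^sub>f \<nu> \<kappa>
    using twice_differentiable_GDERIV[OF J_diff] J_max nu_pos PL Lf_pos grad_lip kappa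
    by unfold_locales
  obtain B where B: "\<And>u. B \<le> primal J u"
    using P_bdd unfolding bdd_below_def by blast
  define X\<^sub>0 where "X\<^sub>0 = (\<lambda>\<omega>. ((x0 \<omega>, y0 \<omega>), (mx0 \<omega>, my0 \<omega>)))"
  define m where "m T i \<omega> = (xmom (st T i \<omega>), ymom (st T i \<omega>))" for T i \<omega>
  interpret stream: sample_stream M S \<xi> X\<^sub>0
    using samples_indep init_indep unfolding X\<^sub>0_def by unfold_locales
  have z0: "z T 0 = (\<lambda>\<omega>. (x0 \<omega>, y0 \<omega>))" and m0: "m T 0 = (\<lambda>\<omega>. (mx0 \<omega>, my0 \<omega>))" for T
    by (auto simp: z m_def st)
  have fst_borel: "(\<lambda>w::((real ^ 'm) \<times> (real ^ 'n)) \<times> ((real ^ 'm) \<times> (real ^ 'n)). fst w) \<in> borel_measurable borel"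
    and snd_borel: "(\<lambda>w::((real ^ 'm) \<times> (real ^ 'n)) \<times> ((real ^ 'm) \<times> (real ^ 'n)). snd w) \<in> borel_measurable borel"
    by (intro borel_measurable_continuous_onI continuous_intros)+
  have z0_past: "(\<lambda>\<omega>. (x0 \<omega>, y0 \<omega>)) \<in> borel_measurable (stream.past 0)"
    and m0_past: "(\<lambda>\<omega>. (mx0 \<omega>, my0 \<omega>)) \<in> borel_measurable (stream.past 0)"
    using measurable_compose[OF stream.init_past fst_borel] measurable_compose[OF stream.init_past snd_borel]
    by (simp_all add: X\<^sub>0_def)
  note z0_borel = measurable_from_subalg[OF stream.subalgebra_past z0_past]
    and m0_borel = measurable_from_subalg[OF stream.subalgebra_past m0_past]
  have grad_J_borel: "grad J \<in> borel_measurable borel"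
    by (intro borel_measurable_continuous_onI lipschitz_on_continuous_on[OF grad_lip])
  define gaps where "gaps \<omega> = (1 + 4 * P.smoothness * (primal J (x0 \<omega>) - B))
      + (1 + 2 * \<kappa>) * (1 + 4 * L\<^sub>f * (primal J (x0 \<omega>) - J (x0 \<omega>, y0 \<omega>)))" for \<omega>
  have dev_int: "integrable M (\<lambda>\<omega>. norm ((mx0 \<omega>, my0 \<omega>) - grad J (x0 \<omega>, y0 \<omega>)))"
  proof (rule Bochner_Integration.integrable_bound)
    show "integrable M (\<lambda>\<omega>. norm (mx0 \<omega>) + norm (my0 \<omega>) + gaps \<omega>)"
      using init_int unfolding gaps_def by simp
    show "(\<lambda>\<omega>. norm ((mx0 \<omega>, my0 \<omega>) - grad J (x0 \<omega>, y0 \<omega>))) \<in> borel_measurable M"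
      using m0_borel measurable_compose[OF z0_borel grad_J_borel] by measurable
    have "norm ((mx0 \<omega>, my0 \<omega>) - grad J (x0 \<omega>, y0 \<omega>)) \<le> norm (mx0 \<omega>) + norm (my0 \<omega>) + gaps \<omega>" for \<omega>
      using P.norm_grad_le_gaps[OF B, of "x0 \<omega>" "y0 \<omega>"] norm_Pair_le[of "mx0 \<omega>" "my0 \<omega>"]
        norm_triangle_ineq4[of "(mx0 \<omega>, my0 \<omega>)" "grad J (x0 \<omega>, y0 \<omega>)"]
      unfolding gaps_def by linarith
    then show "AE \<omega> in M. norm (norm ((mx0 \<omega>, my0 \<omega>) - grad J (x0 \<omega>, y0 \<omega>)))
        \<le> norm (norm (mx0 \<omega>) + norm (my0 \<omega>) + gaps \<omega>)"
      by (intro AE_I2) (simp only: real_norm_def abs_norm_cancel order_trans[OF _ abs_ge_self])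
  qed
  have lyap_int: "integrable M (\<lambda>\<omega>. 2 * primal J (x0 \<omega>) - J (x0 \<omega>, y0 \<omega>))"
    using init_int by simp
  have run: "hcmm_run J L\<^sub>f \<nu> \<kappa> M S \<xi> X\<^sub>0 Q (z T) (m T) (\<mu>x T) (\<mu>y T) (\<beta>x T) \<sigma> \<sigma>h L\<^sub>h B" if T: "T \<ge> 1" for T
  proof -
    \<comment> \<open>\<open>\<beta>y T\<close> is rewritten as \<open>\<beta>x T\<close>, so that
      the two momenta share one recursion.\<close>
    have st': "(\<lambda>i. st T i \<omega>) = hcmm2 (\<mu>x T) (\<mu>y T) (\<beta>x T) (\<beta>x T) Q
        \<lparr>xvar = x0 \<omega>, yvar = y0 \<omega>, xmom = mx0 \<omega>, ymom = my0 \<omega>, calls = 0\<rparr> (\<lambda>k. \<xi> k \<omega>)" for \<omega>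
      using stab_beta[OF T] by (simp add: st fun_eq_iff)
    have mu: "6 * \<kappa> * \<mu>x T \<le> \<mu>y T"
      using stab_mu[OF T] P.kappa_pos by (simp add: pos_le_divide_eq mult_ac)
    show ?thesis
    proof unfold_locales
      show "z T (Suc i) \<omega> = z T i \<omega> + normalized_step (\<mu>x T) (\<mu>y T) (m T i \<omega>)" for i \<omega>
        using hcmm2_position[OF st', of i \<omega>] by (simp add: z m_def)
      show "m T (Suc i) \<omega> = (1 - \<beta>x T) *\<^sub>R (m T i \<omega>
            + hess (\<lambda>z. Q z (\<xi> (Suc i) \<omega>)) (z T (Suc i) \<omega>) (normalized_step (\<mu>x T) (\<mu>y T) (m T i \<omega>)))
          + \<beta>x T *\<^sub>R grad (\<lambda>z. Q z (\<xi> (Suc i) \<omega>)) (z T (Suc i) \<omega>)" for i \<omega>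
        using hcmm2_momentum[OF st', of i \<omega>] by (simp add: z m_def)
      show "z T 0 \<in> borel_measurable (stream.past 0)" "m T 0 \<in> borel_measurable (stream.past 0)"
        using z0_past m0_past by (simp_all add: z0 m0)
      show "integrable M (\<lambda>\<omega>. norm (m T 0 \<omega> - grad J (z T 0 \<omega>)))"
        using dev_int by (simp add: z0 m0)
      show "integrable M (\<lambda>\<omega>. 2 * primal J (fst (z T 0 \<omega>)) - J (z T 0 \<omega>))"
        using lyap_int by (simp add: z0)
      show "unbiased_bounded_noise M Q J \<sigma> \<sigma>h (z T) \<xi> i" if "i \<ge> 1" for i
        using noise[OF T that] .
    qed (use Q_grad_meas Q_hess_meas J_diff hess_lip borel_measurable_normalized_step norm_normalized_step_le
        params_pos[OF T] stab_beta[OF T] B mu c3 T in auto)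
  qed
  have x_z: "x T i \<omega> = fst (z T i \<omega>)" for T i \<omega> by (simp add: x z)
  have int: "integrable M (\<lambda>\<omega>. norm (grad (primal J) (x T i \<omega>)))" if "T \<ge> 1" for T i
    using hcmm_run.stationarity_integrable[OF run[OF that], of i] by (simp add: x_z)
  define A where "A T = 1 / real T * (\<Sum>i<T. \<integral>\<omega>. norm (grad (primal J) (x T i \<omega>)) \<partial>M)" for T
  define C where "C = (\<integral>\<omega>. 2 * primal J (x0 \<omega>) - J (x0 \<omega>, y0 \<omega>) \<partial>M) - B"
  define E where "E = (\<integral>\<omega>. norm ((mx0 \<omega>, my0 \<omega>) - grad J (x0 \<omega>, y0 \<omega>)) \<partial>M)"
  have C: "C \<ge> 0"
  proof -
    have "C = (\<integral>\<omega>. 2 * primal J (x0 \<omega>) - J (x0 \<omega>, y0 \<omega>) - B \<partial>M)"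
      unfolding C_def by (subst Bochner_Integration.integral_diff[OF lyap_int]) (simp_all add: prob_space)
    also have "\<dots> \<ge> 0"
    proof (intro integral_nonneg_AE AE_I2)
      show "0 \<le> 2 * primal J (x0 \<omega>) - J (x0 \<omega>, y0 \<omega>) - B" for \<omega>
        using B[of "x0 \<omega>"] P.le_primal[of "x0 \<omega>" "y0 \<omega>"] by linarith
    qed
    finally show ?thesis .
  qed
  have E: "E \<ge> 0" by (simp add: E_def)
  have Lh: "L\<^sub>h \<ge> 0" using hess_lip by (rule lipschitz_on_nonneg)
  have bound: "A T \<le> (C + 2 * (c\<^sub>3 * \<mu>y T + \<mu>y T) * (E / \<beta>x T
        + real T * (L\<^sub>h * ((c\<^sub>3 * \<mu>y T)\<^sup>2 + (\<mu>y T)\<^sup>2) / \<beta>x T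
            + sqrt (2 * ((\<sigma>h * sqrt ((c\<^sub>3 * \<mu>y T)\<^sup>2 + (\<mu>y T)\<^sup>2))\<^sup>2 + (\<beta>x T * \<sigma>)\<^sup>2) / \<beta>x T)))
        + real T * ((2 * P.smoothness + L\<^sub>f) * ((c\<^sub>3 * \<mu>y T)\<^sup>2 + (\<mu>y T)\<^sup>2))) / (real T * (c\<^sub>3 * \<mu>y T))"
    (is "_ \<le> ?R / _") if T: "T \<ge> 1" for T
  proof -
    interpret R: hcmm_run J L\<^sub>f \<nu> \<kappa> M S \<xi> X\<^sub>0 Q "z T" "m T" "\<mu>x T" "\<mu>y T" "\<beta>x T" \<sigma> \<sigma>h L\<^sub>h B
      by (rule run[OF T])
    have pos: "0 < c\<^sub>3 * \<mu>y T" using R.\<mu>y c3 by simp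
    have "c\<^sub>3 * \<mu>y T * (\<Sum>i<T. \<integral>\<omega>. norm (grad (primal J) (x T i \<omega>)) \<partial>M) \<le> ?R"
      using R.sum_expectation_stationarity[of T]
      unfolding R.noise_level_def R.curvature_def unfolding c3(3)[OF T]
      by (simp add: x_z C_def E_def z0 m0 P.lyapunov_def)
    moreover have "A T = c\<^sub>3 * \<mu>y T * (\<Sum>i<T. \<integral>\<omega>. norm (grad (primal J) (x T i \<omega>)) \<partial>M) / (real T * (c\<^sub>3 * \<mu>y T))"
      using R.\<mu>y c3(1) T by (simp add: A_def)
    ultimately show ?thesis
      using pos T by (simp only:) (intro divide_right_mono, auto)
  qed
  obtain a\<^sub>1 b\<^sub>1 where \<mu>_bounds: "0 < a\<^sub>1" "\<forall>\<^sub>F T in sequentially.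
      a\<^sub>1 * (1 / real T powr (1 / 3))\<^sup>2 \<le> \<mu>y T \<and> \<mu>y T \<le> b\<^sub>1 * (1 / real T powr (1 / 3))\<^sup>2"
    using bigtheta_powr_bounds[OF mu_rate params_pos[THEN conjunct1]] .
  obtain a\<^sub>2 b\<^sub>2 where \<beta>_bounds: "0 < a\<^sub>2" "\<forall>\<^sub>F T in sequentially.
      a\<^sub>2 * (1 / real T powr (1 / 3))\<^sup>2 \<le> \<beta>x T \<and> \<beta>x T \<le> b\<^sub>2 * (1 / real T powr (1 / 3))\<^sup>2"
    using bigtheta_powr_bounds[OF beta_rate params_pos[THEN conjunct2]] .
  \<comment> \<open>One pair of constants that brackets the step size and the smoothing factor
    simultaneously.\<close>
  define a where "a = min a\<^sub>1 a\<^sub>2"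
  define b where "b = max b\<^sub>1 b\<^sub>2"
  define K where "K = C / (c\<^sub>3 * a) + 4 / c\<^sub>3 * (E / a + 2 * L\<^sub>h * b\<^sup>2 / a
      + sqrt (2 * (2 * \<sigma>h\<^sup>2 * b\<^sup>2 + b\<^sup>2 * \<sigma>\<^sup>2) / a)) + 2 * (2 * P.smoothness + L\<^sub>f) * b / c\<^sub>3"
  have "\<forall>\<^sub>F T in sequentially. A T \<le> K * (1 / real T powr (1 / 3))"
    using \<mu>_bounds(2) \<beta>_bounds(2) eventually_ge_at_top[of 1]
  proof eventually_elim
    case (elim T)
    define t where "t = 1 / real T powr (1 / 3)"
    have tpos: "0 < t" using elim by (simp add: t_def)
    have t1: "t \<le> 1" using elim by (simp add: t_def ge_one_powr_ge_zero)
    have "(real T powr (1 / 3)) ^ 3 = real T"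
      using elim powr_realpow[of "real T powr (1 / 3)" 3] by (simp add: powr_powr)
    then have T: "real T = 1 / t ^ 3"
      by (simp add: t_def power_one_over)
    have le: "a * t\<^sup>2 \<le> a\<^sub>1 * t\<^sup>2" "a * t\<^sup>2 \<le> a\<^sub>2 * t\<^sup>2" "b\<^sub>1 * t\<^sup>2 \<le> b * t\<^sup>2" "b\<^sub>2 * t\<^sup>2 \<le> b * t\<^sup>2"
      by (auto simp: a_def b_def intro: mult_right_mono)
    show ?case
      unfolding K_def t_def[symmetric]
      by (rule order_trans[OF bound[OF elim(3)] rate_arithmetic[OF tpos t1 T]])
        (use elim le c3 C E Lh P.smoothness_pos Lf_pos \<mu>_bounds(1) \<beta>_bounds(1) in
          \<open>auto simp: a_def t_def[symmetric]\<close>)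
  qed
  \<comment> \<open>Enlarging \<open>K\<close> makes the constant strictly positive, as the
    inversion to an iteration count demands.\<close>
  then have rate: "\<forall>\<^sub>F T in sequentially. A T \<le> (\<bar>K\<bar> + 1) * (1 / real T powr (1 / 3))"
    by (rule eventually_mono) (auto elim!: order_trans intro!: divide_right_mono)
  then obtain T1 where T1: "\<And>T. T \<ge> T1 \<Longrightarrow> A T \<le> (\<bar>K\<bar> + 1) * (1 / real T powr (1 / 3))"
    unfolding eventually_sequentially by blast
  have A_nonneg: "A T \<ge> 0" for T by (simp add: A_def sum_nonneg)
  have A_bigo: "A \<in> O(\<lambda>T. 1 / real T powr (1 / 3))"
    by (rule bigoI[of _ "\<bar>K\<bar> + 1"], rule eventually_mono[OF rate]) (use A_nonneg in simp)
  have rate_from: "A T \<le> (\<bar>K\<bar> + 1) * (1 / real T powr (1 / 3))" if "T \<ge> max T1 1" for T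
    using that by (intro T1) simp
  have K_pos: "\<bar>K\<bar> + 1 > 0" by simp
  obtain N :: "real \<Rightarrow> nat" where N_bigo: "(\<lambda>\<epsilon>. real (N \<epsilon>)) \<in> O[at_right 0](\<lambda>\<epsilon>. 1 / \<epsilon> ^ 3)"
    and N: "\<And>\<epsilon>. \<epsilon> > 0 \<Longrightarrow> N \<epsilon> \<ge> 1 \<and> A (N \<epsilon>) \<le> \<epsilon>"
    using cubic_iteration_complexity[OF rate_from K_pos max.cobounded2] by blast
  have calls: "calls (st T i \<omega>) = 6 * i" for T i \<omega>
    by (simp add: st calls_hcmm2)
  \<comment> \<open>If every expected gradient norm exceeded \<open>\<epsilon>\<close>, so would
    their average.\<close>
  have best: "\<exists>i<N \<epsilon>. stationary_point M (primal J) \<epsilon> (x (N \<epsilon>) i)" if \<epsilon>: "\<epsilon> > 0" for \<epsilon>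
  proof (rule ccontr)
    assume "\<not> ?thesis"
    then have "\<epsilon> < (\<integral>\<omega>. norm (grad (primal J) (x (N \<epsilon>) i \<omega>)) \<partial>M)" if "i < N \<epsilon>" for i
      using that int N[OF \<epsilon>] by (auto simp: stationary_point_def not_le)
    then have "(\<Sum>i<N \<epsilon>. \<epsilon>) < (\<Sum>i<N \<epsilon>. \<integral>\<omega>. norm (grad (primal J) (x (N \<epsilon>) i \<omega>)) \<partial>M)"
      using N[OF \<epsilon>] by (intro sum_strict_mono) (auto simp: lessThan_empty_iff)
    then have "\<epsilon> < A (N \<epsilon>)"
      using N[OF \<epsilon>] by (simp add: A_def field_simps)
    with N[OF \<epsilon>] show False by simp
  qed
  have random: "stationary_point (M \<Otimes>\<^sub>M measure_pmf (pmf_of_set {..<N \<epsilon>})) (primal J) \<epsilon>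
      (\<lambda>(\<omega>, i). x (N \<epsilon>) i \<omega>)" if \<epsilon>: "\<epsilon> > 0" for \<epsilon>
  proof -
    have eq: "(\<lambda>p. norm (grad (primal J) (case p of (\<omega>, i) \<Rightarrow> x (N \<epsilon>) i \<omega>)))
        = (\<lambda>(\<omega>, i). norm (grad (primal J) (x (N \<epsilon>) i \<omega>)))" by auto
    show ?thesis
      unfolding stationary_point_def eq
      using expectation_uniform_index[of "\<lambda>i \<omega>. norm (grad (primal J) (x (N \<epsilon>) i \<omega>))" "N \<epsilon>"] int N[OF \<epsilon>]
      by (auto simp: A_def)
  qed
  \<comment> \<open>The average itself serves as \<open>r1\<close>, with zero for the others: the
    inequality is demanded for every \<open>T \<ge> 1\<close>, while the rate is asymptotic, so
    small \<open>T\<close> are covered by equality.\<close>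
  have "\<exists>r1 r2 r3 :: nat \<Rightarrow> real.
      r1 \<in> O(\<lambda>T. 1 / real T powr (1 / 3)) \<and> r2 \<in> O(\<lambda>T. 1 / real T) \<and> r3 \<in> O(\<lambda>T. 1 / real T powr (2 / 3)) \<and>
      (\<forall>T\<ge>1. 1 / real T * (\<Sum>i<T. \<integral>\<omega>. norm (grad (primal J) (x T i \<omega>)) \<partial>M) \<le> r1 T + r2 T + r3 T)"
    using A_bigo by (intro exI[of _ A] exI[of _ "\<lambda>_. 0"]) (simp add: A_def)
  moreover have "\<exists>N C :: real \<Rightarrow> nat.
        (\<lambda>\<epsilon>. real (N \<epsilon>)) \<in> O[at_right 0](\<lambda>\<epsilon>. 1 / \<epsilon> ^ 3) \<and>
        (\<lambda>\<epsilon>. real (C \<epsilon>)) \<in> O[at_right 0](\<lambda>\<epsilon>. 1 / \<epsilon> ^ 3) \<and>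
        (\<forall>\<epsilon>>0. N \<epsilon> \<ge> 1 \<and>
           (\<forall>\<omega>\<in>space M. calls (st (N \<epsilon>) (N \<epsilon>) \<omega>) \<le> C \<epsilon>) \<and>
           (\<exists>i<N \<epsilon>. stationary_point M (primal J) \<epsilon> (x (N \<epsilon>) i)) \<and>
           stationary_point (M \<Otimes>\<^sub>M measure_pmf (pmf_of_set {..<N \<epsilon>})) (primal J) \<epsilon>
             (\<lambda>(\<omega>, i). x (N \<epsilon>) i \<omega>))"
    \<comment> \<open>Each iteration costs six evaluations, four Hessian products and two gradients,
      so oracle and iteration complexity have the same order.\<close>
    using N_bigo N best random by (intro exI[of _ N] exI[of _ "\<lambda>\<epsilon>. 6 * N \<epsilon>"]) (simp add: calls)
  ultimately show ?thesis
    using P.GDERIV_primal int by blast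
qed

end
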